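(* Let $m\geq1$, let $Z$ be an infinite-dimensional Banach space and let $r\geq1$. Assume that $$\mathcal{L}(^{m+1}\ell_{1},\dots,\ell_{1},Z;\mathbb{K})=\Pi_{r,1}^{mult}(^{m+1}\ell_{1},\dots,\ell_{1},Z;\mathbb{K})$$ (with $m$ copies of $\ell_1$). Then $r\geq\frac{4q_{Z}}{3q_{Z}+2}$.
   Context: Scalars are $\mathbb K=\mathbb R$ or $\mathbb C$. $q_Z=\inf\{2\leq q\leq\infty:\ Z\text{ has cotype }q\}$; if $q_Z=\infty$ the expression $\frac{4q_Z}{3q_Z+2}$ is read as $\frac43$. $\mathcal L(^NX_1,\dots,X_N;Y)$ is the space of continuous $N$-linear maps $X_1\times\cdots\times X_N\to Y$. For a sequence $x=(x_i)$ in a Banach space $X$, $\omega_p(x)=\sup_{\|x^*\|\leq 1}\big(\sum_i |x^*(x_i)|^p\big)^{1/p}$. An $N$-linear map $T:X_1\times\cdots\times X_N\to Y$ is multiple $(r,p)$-summing if there is $C>0$ such that for all sequences $x(j)=(x_i(j))_i\subset X_j$, $$\Big(\sum_{i_1,\dots,i_N\in\mathbb N}\|T(x_{i_1}(1),\dots,x_{i_N}(N))\|^r\Big)^{1/r}\leq C\,\omega_p(x(1))\cdots\omega_p(x(N)).$$ $\Pi^{mult}_{r,p}(^NX_1,\dots,X_N;Y)$ is the class of all such (continuous) maps. *)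

theory Defs
  imports "HOL-Analysis.Analysis"
begin

text \<open>
  Normed spaces over a scalar field \<open>'k\<close>, which is instantiated with \<open>real\<close> and \<open>complex\<close>.
  The norm and the underlying real structure come from the type class; the scalar
  multiplication of \<open>'k\<close> is a parameter, because the library has no class of complex normed
  spaces. For \<open>'k = real\<close> the last axiom forces \<open>sm = scaleR\<close>.
\<close>

locale normed_space_over = vector_space sm
  for sm :: "'k::real_normed_field \<Rightarrow> 'a::real_normed_vector \<Rightarrow> 'a" +
  assumes norm_sm: "norm (sm a x) = norm a * norm x"
    and sm_of_real: "sm (of_real c) x = c *\<^sub>R x"

definition infinite_dimensional ::
  "('k::field \<Rightarrow> 'a::ab_group_add \<Rightarrow> 'a) \<Rightarrow> bool" where
  "infinite_dimensional sm \<longleftrightarrow> \<not> (\<exists>B. finite B \<and> module.span sm B = UNIV)"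

subsection \<open>The space of absolutely summable scalar sequences\<close>

typedef (overloaded) 'k ell1 = "{x :: nat \<Rightarrow> 'k::real_normed_vector. summable (\<lambda>n. norm (x n))}"
  morphisms ell1_nth Abs_ell1
  by (rule exI[of _ "\<lambda>_. 0"]) simp

setup_lifting type_definition_ell1

lemma summable_norm_ell1: "summable (\<lambda>n. norm (ell1_nth x n))"
  using ell1_nth[of x] by simp

instantiation ell1 :: (real_normed_vector) real_normed_vector
begin

lift_definition zero_ell1 :: "'a ell1" is "\<lambda>_. 0" by simp

lift_definition plus_ell1 :: "'a ell1 \<Rightarrow> 'a ell1 \<Rightarrow> 'a ell1" is "\<lambda>x y n. x n + y n"
  subgoal for x y
    by (rule summable_comparison_test'[OF summable_add, of "\<lambda>n. norm (x n)" "\<lambda>n. norm (y n)" 0])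
      (auto intro: norm_triangle_ineq)
  done

lift_definition uminus_ell1 :: "'a ell1 \<Rightarrow> 'a ell1" is "\<lambda>x n. - x n" by simp

lift_definition minus_ell1 :: "'a ell1 \<Rightarrow> 'a ell1 \<Rightarrow> 'a ell1" is "\<lambda>x y n. x n - y n"
  subgoal for x y
    by (rule summable_comparison_test'[OF summable_add, of "\<lambda>n. norm (x n)" "\<lambda>n. norm (y n)" 0])
      (auto intro: norm_triangle_ineq4)
  done

lift_definition scaleR_ell1 :: "real \<Rightarrow> 'a ell1 \<Rightarrow> 'a ell1" is "\<lambda>c x n. c *\<^sub>R x n"
  by (simp add: summable_mult)

lift_definition norm_ell1 :: "'a ell1 \<Rightarrow> real" is "\<lambda>x. \<Sum>n. norm (x n)" .

definition "dist_ell1 (x :: 'a ell1) y = norm (x - y)"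

definition "sgn_ell1 (x :: 'a ell1) = inverse (norm x) *\<^sub>R x"

definition [code del]:
  "uniformity_ell1 = (INF e\<in>{0<..}. principal {(x, y :: 'a ell1). dist x y < e})"

definition [code del]:
  "open_ell1 (U :: 'a ell1 set) \<longleftrightarrow>
    (\<forall>x\<in>U. eventually (\<lambda>(x', y). x' = x \<longrightarrow> y \<in> U) uniformity)"

instance
proof
  fix x y z :: "'a ell1" and a b :: real
  show "x + y + z = x + (y + z)" by transfer (simp add: add.assoc)
  show "x + y = y + x" by transfer (simp add: add.commute)
  show "0 + x = x" by transfer simp
  show "- x + x = 0" by transfer simp
  show "x - y = x + - y" by transfer simp
  show "a *\<^sub>R (x + y) = a *\<^sub>R x + a *\<^sub>R y" by transfer (simp add: scaleR_add_right)
  show "(a + b) *\<^sub>R x = a *\<^sub>R x + b *\<^sub>R x" by transfer (simp add: scaleR_add_left)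
  show "a *\<^sub>R b *\<^sub>R x = (a * b) *\<^sub>R x" by transfer simp
  show "1 *\<^sub>R x = x" by transfer simp
  show "dist x y = norm (x - y)" by (rule dist_ell1_def)
  show "sgn x = inverse (norm x) *\<^sub>R x" by (rule sgn_ell1_def)
  show "uniformity = (INF e\<in>{0<..}. principal {(x, y :: 'a ell1). dist x y < e})"
    by (rule uniformity_ell1_def)
  show "open U \<longleftrightarrow> (\<forall>x\<in>U. eventually (\<lambda>(x', y). x' = x \<longrightarrow> y \<in> U) uniformity)"
    for U :: "'a ell1 set"
    by (rule open_ell1_def)
  show "norm x = 0 \<longleftrightarrow> x = 0"
    by transfer (auto simp: suminf_eq_zero_iff fun_eq_iff)
  show "norm (x + y) \<le> norm x + norm y"
  proof transfer
    fix x y :: "nat \<Rightarrow> 'a"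
    assume s: "summable (\<lambda>n. norm (x n))" "summable (\<lambda>n. norm (y n))"
    have "(\<Sum>n. norm (x n + y n)) \<le> (\<Sum>n. norm (x n) + norm (y n))"
      by (intro suminf_le norm_triangle_ineq summable_add s
          summable_comparison_test'[OF summable_add[OF s]]) (simp add: norm_triangle_ineq)
    then show "(\<Sum>n. norm (x n + y n)) \<le> (\<Sum>n. norm (x n)) + (\<Sum>n. norm (y n))"
      using suminf_add[OF s] by simp
  qed
  show "norm (a *\<^sub>R x) = \<bar>a\<bar> * norm x"
    by transfer (simp add: suminf_mult)
qed

end

lift_definition ell1_scale :: "'k::real_normed_field \<Rightarrow> 'k ell1 \<Rightarrow> 'k ell1"
  is "\<lambda>c x n. c * x n"
  by (simp add: norm_mult summable_mult)

lemma normed_space_over_ell1: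
  "normed_space_over (ell1_scale :: 'k::real_normed_field \<Rightarrow> 'k ell1 \<Rightarrow> 'k ell1)"
proof
  fix a b :: 'k and c :: real and x y :: "'k ell1"
  show "ell1_scale a (x + y) = ell1_scale a x + ell1_scale a y"
    by transfer (simp add: algebra_simps)
  show "ell1_scale (a + b) x = ell1_scale a x + ell1_scale b x"
    by transfer (simp add: algebra_simps)
  show "ell1_scale a (ell1_scale b x) = ell1_scale (a * b) x"
    by transfer (simp add: algebra_simps)
  show "ell1_scale 1 x = x" by transfer simp
  show "norm (ell1_scale a x) = norm a * norm x"
    by transfer (simp add: norm_mult suminf_mult)
  show "ell1_scale (of_real c) x = c *\<^sub>R x"
    by transfer (simp add: scaleR_conv_of_real)
qed

subsection \<open>Cotype\<close>

text \<open>The second moment of \<open>\<Sum>i<n. \<epsilon> i *\<^sub>R x i\<close> for independent uniform signs \<open>\<epsilon>\<close>, to the power 1/2.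
  By Kahane's inequality another moment would give the same notion of cotype.\<close>

definition rademacher_average :: "nat \<Rightarrow> (nat \<Rightarrow> 'a::real_normed_vector) \<Rightarrow> real" where
  "rademacher_average n x =
    sqrt ((\<Sum>\<epsilon>\<in>{..<n} \<rightarrow>\<^sub>E {-1, 1}. (norm (\<Sum>i<n. \<epsilon> i *\<^sub>R x i))\<^sup>2) / 2 ^ n)"

definition has_cotype :: "'a::real_normed_vector itself \<Rightarrow> ereal \<Rightarrow> bool" where
  "has_cotype _ q \<longleftrightarrow> 2 \<le> q \<and> (\<exists>C. \<forall>n (x :: nat \<Rightarrow> 'a).
    if q = \<infinity> then (\<forall>i<n. norm (x i) \<le> C * rademacher_average n x)
    else (\<Sum>i<n. norm (x i) powr real_of_ereal q) powr (1 / real_of_ereal q)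
           \<le> C * rademacher_average n x)"

definition cotype_index :: "'a::real_normed_vector itself \<Rightarrow> ereal" where
  "cotype_index Z = Inf {q. has_cotype Z q}"

definition cotype_bound :: "ereal \<Rightarrow> real" where
  "cotype_bound q =
    (if q = \<infinity> then 4 / 3 else 4 * real_of_ereal q / (3 * real_of_ereal q + 2))"

subsection \<open>Multiple summing maps\<close>

definition ennreal_root :: "real \<Rightarrow> ennreal \<Rightarrow> ennreal" where
  "ennreal_root p t = (if t = \<infinity> then \<infinity> else ennreal (enn2real t powr (1 / p)))"

definition dual_ball ::
  "('k::real_normed_field \<Rightarrow> 'a::real_normed_vector \<Rightarrow> 'a) \<Rightarrow> ('a \<Rightarrow> 'k) set" where
  "dual_ball sm =
    {f. Vector_Spaces.linear sm (*) f \<and> bounded_linear f \<and> onorm f \<le> 1}"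

text \<open>The value is \<open>\<infinity>\<close> if the sequence is not weakly \<open>p\<close>-summable.\<close>

definition weak_norm ::
  "real \<Rightarrow> ('k::real_normed_field \<Rightarrow> 'a::real_normed_vector \<Rightarrow> 'a) \<Rightarrow> (nat \<Rightarrow> 'a) \<Rightarrow> ennreal" where
  "weak_norm p sm x =
    (SUP f\<in>dual_ball sm. ennreal_root p (\<Sum>\<^sub>\<infinity>i\<in>UNIV. ennreal (norm (f (x i)) powr p)))"

text \<open>
  Maps on \<open>X \<times> \<dots> \<times> X \<times> Z\<close> with one factor \<open>X\<close> for each element of the finite (nonempty) index
  type \<open>'m\<close>, so with \<open>m = CARD('m)\<close> copies of \<open>X\<close>. The first argument of the map is the tuple of
  the \<open>X\<close>-coordinates. Continuity refers to the product topology.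
\<close>

definition continuous_multilinear ::
  "('k::real_normed_field \<Rightarrow> 'x::real_normed_vector \<Rightarrow> 'x) \<Rightarrow>
   ('k \<Rightarrow> 'z::real_normed_vector \<Rightarrow> 'z) \<Rightarrow>
   ('k \<Rightarrow> 'y::real_normed_vector \<Rightarrow> 'y) \<Rightarrow> (('m::finite \<Rightarrow> 'x) \<Rightarrow> 'z \<Rightarrow> 'y) set" where
  "continuous_multilinear smX smZ smY =
    {T. (\<forall>x j z. Vector_Spaces.linear smX smY (\<lambda>u. T (x(j := u)) z)) \<and>
        (\<forall>x. Vector_Spaces.linear smZ smY (T x)) \<and>
        continuous_on UNIV (\<lambda>(x, z). T x z)}"

text \<open>
  In \<open>ennreal\<close> we have \<open>0 * \<infinity> = 0\<close>. This is harmless below: a vanishing weak norm forces the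
  sequence to vanish, and then so does the left-hand side.
\<close>

definition multiple_summing ::
  "real \<Rightarrow> real \<Rightarrow>
   ('k::real_normed_field \<Rightarrow> 'x::real_normed_vector \<Rightarrow> 'x) \<Rightarrow>
   ('k \<Rightarrow> 'z::real_normed_vector \<Rightarrow> 'z) \<Rightarrow>
   ('k \<Rightarrow> 'y::real_normed_vector \<Rightarrow> 'y) \<Rightarrow> (('m::finite \<Rightarrow> 'x) \<Rightarrow> 'z \<Rightarrow> 'y) set" where
  "multiple_summing r p smX smZ smY =
    {T \<in> continuous_multilinear smX smZ smY.
      \<exists>C>0. \<forall>(x :: 'm \<Rightarrow> nat \<Rightarrow> 'x) (z :: nat \<Rightarrow> 'z).
        ennreal_root r
          (\<Sum>\<^sub>\<infinity>(i, k)\<in>(UNIV :: (('m \<Rightarrow> nat) \<times> nat) set).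
            ennreal (norm (T (\<lambda>j. x j (i j)) (z k)) powr r))
        \<le> ennreal C * (\<Prod>j\<in>UNIV. weak_norm p smX (x j)) * weak_norm p smZ z}"

end

theory Submission
  imports Defs
begin

text \<open>
  If \<open>r\<close> is smaller than the bound, then \<open>\<sigma> = 2 / r - 3 / 2\<close> exceeds \<open>1 / q\<^sub>Z\<close>. It suffices to find, for
  arbitrarily small \<open>c > 0\<close>, \<open>n = 2\<^sup>t\<close> vectors \<open>z\<^sub>l\<close> of norm at least \<open>1\<close> with \<open>\<omega>\<^sub>1(z) \<le> c n powr \<sigma>\<close>. Indeed,
  take norming functionals \<open>\<phi>\<^sub>i\<close> of the \<open>z\<^sub>i\<close>, a Sylvester sign matrix \<open>a\<close> and the rows
  \<open>x\<^sub>k = \<Sum>i<n. a\<^sub>k\<^sub>i e\<^sub>i\<close>, for which \<open>\<omega>\<^sub>1(x) \<le> n powr (3 / 2)\<close>. The form \<open>T(e\<^sub>i, z) = \<plusminus>\<phi>\<^sub>i(z)\<close>, with suitable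
  signs, satisfies \<open>\<Sum>k<n. \<Sum>l<n. \<bar>T(x\<^sub>k, z\<^sub>l)\<bar> powr r \<ge> n\<^sup>2\<close>. Countably many such blocks fit into one
  bounded form on \<open>\<ell>\<^sub>1 \<times> Z\<close>, and \<open>n powr (2 / r) = n powr (3 / 2 + \<sigma>)\<close> contradicts summability.

  The vectors are found without the Maurey--Pisier theorem. Failure of cotype slightly below \<open>q\<^sub>Z\<close>
  gives vectors of norm at least \<open>1\<close> with a small Rademacher average. Repeated random halving of the
  index set, controlled by the Ledoux--Talagrand contraction principle, adds to \<open>\<omega>\<^sub>1\<close> at most the
  Rademacher averages over the parts. Cotype slightly above \<open>q\<^sub>Z\<close> bounds the sum of these averages over
  any partition. At the start, \<open>\<omega>\<^sub>1(z)\<close> is at most \<open>sqrt n\<close> times the Rademacher average, and because of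
  \<open>q\<^sub>Z > 2\<close> this factor is used up while the parts are still large.
\<close>

subsection \<open>Averages over signs\<close>

text \<open>The expectation for independent uniform signs. Extensional functions keep the set of
  sign patterns finite, with \<open>2 ^ card S\<close> elements for finite \<open>S\<close>.\<close>

definition sign_mean :: "'i set \<Rightarrow> (('i \<Rightarrow> real) \<Rightarrow> real) \<Rightarrow> real" where
  "sign_mean S F = (\<Sum>\<epsilon>\<in>S \<rightarrow>\<^sub>E {-1, 1}. F \<epsilon>) / 2 ^ card S"

definition sign_avg ::
  "'i set \<Rightarrow> ('i \<Rightarrow> 'a::real_normed_vector) \<Rightarrow> ('a \<Rightarrow> real) \<Rightarrow> real" where
  "sign_avg S z f = sign_mean S (\<lambda>\<epsilon>. f (\<Sum>i\<in>S. \<epsilon> i *\<^sub>R z i))"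

definition rad :: "'i set \<Rightarrow> ('i \<Rightarrow> 'a::real_normed_vector) \<Rightarrow> real" where
  "rad S z = sqrt (sign_avg S z (\<lambda>v. (norm v)\<^sup>2))"

lemma rademacher_average_eq_rad: "rademacher_average n x = rad {..<n} x"
  by (simp add: rademacher_average_def rad_def sign_avg_def sign_mean_def)

lemma finite_signs: "finite S \<Longrightarrow> finite (S \<rightarrow>\<^sub>E {-1, 1::real})"
  by (rule finite_PiE) auto

lemma card_signs: "finite S \<Longrightarrow> card (S \<rightarrow>\<^sub>E {-1, 1::real}) = 2 ^ card S"
  by (simp add: card_funcsetE numeral_2_eq_2)

lemma sign_mean_empty [simp]: "sign_mean {} F = F (\<lambda>_. undefined)"
  by (simp add: sign_mean_def)

text \<open>Conditioning on the sign at \<open>a\<close>; the inductions over the set of signs rest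
  on this identity.\<close>

lemma sign_mean_insert:
  assumes "finite S" "a \<notin> S"
  shows "sign_mean (insert a S) F = sign_mean S (\<lambda>\<epsilon>. (F (\<epsilon>(a := 1)) + F (\<epsilon>(a := -1))) / 2)"
proof -
  have "(\<Sum>\<epsilon>\<in>insert a S \<rightarrow>\<^sub>E {-1, 1}. F \<epsilon>) =
      (\<Sum>(y, \<epsilon>)\<in>{-1, 1} \<times> (S \<rightarrow>\<^sub>E {-1, 1}). F (\<epsilon>(a := y)))"
    unfolding PiE_insert_eq
    by (subst sum.reindex[OF inj_combinator[OF assms(2)]]) (simp add: case_prod_beta comp_def)
  also have "\<dots> = (\<Sum>\<epsilon>\<in>S \<rightarrow>\<^sub>E {-1, 1}. F (\<epsilon>(a := 1)) + F (\<epsilon>(a := -1)))"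
    using assms by (simp add: sum.cartesian_product[symmetric] sum.distrib)
  finally show ?thesis
    using assms by (simp add: sign_mean_def sum_divide_distrib[symmetric])
qed

lemma sign_mean_add: "sign_mean S (\<lambda>\<epsilon>. F \<epsilon> + G \<epsilon>) = sign_mean S F + sign_mean S G"
  by (simp add: sign_mean_def sum.distrib add_divide_distrib)

lemma sign_mean_cmult: "sign_mean S (\<lambda>\<epsilon>. c * F \<epsilon>) = c * sign_mean S F"
  by (simp add: sign_mean_def sum_distrib_left)

lemma sign_mean_half: "sign_mean S (\<lambda>\<epsilon>. F \<epsilon> / 2) = sign_mean S F / 2"
  using sign_mean_cmult[of S "1/2" F] by simp

lemma sign_mean_sum: "sign_mean S (\<lambda>\<epsilon>. \<Sum>b\<in>B. F b \<epsilon>) = (\<Sum>b\<in>B. sign_mean S (F b))"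
  unfolding sign_mean_def by (subst sum.swap) (simp add: sum_divide_distrib)

lemma sign_mean_swap:
  "sign_mean S (\<lambda>\<epsilon>. sign_mean T (F \<epsilon>)) = sign_mean T (\<lambda>\<eta>. sign_mean S (\<lambda>\<epsilon>. F \<epsilon> \<eta>))"
proof -
  have "sign_mean S (\<lambda>\<epsilon>. sign_mean T (F \<epsilon>)) =
      (\<Sum>\<epsilon>\<in>S \<rightarrow>\<^sub>E {-1, 1}. \<Sum>\<eta>\<in>T \<rightarrow>\<^sub>E {-1, 1}. F \<epsilon> \<eta>) / 2 ^ card T / 2 ^ card S"
    by (simp add: sign_mean_def sum_divide_distrib)
  also have "\<dots> = (\<Sum>\<eta>\<in>T \<rightarrow>\<^sub>E {-1, 1}. \<Sum>\<epsilon>\<in>S \<rightarrow>\<^sub>E {-1, 1}. F \<epsilon> \<eta>) / 2 ^ card S / 2 ^ card T"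
    by (subst sum.swap) simp
  also have "\<dots> = sign_mean T (\<lambda>\<eta>. sign_mean S (\<lambda>\<epsilon>. F \<epsilon> \<eta>))"
    by (simp add: sign_mean_def sum_divide_distrib)
  finally show ?thesis .
qed

lemma sign_mean_nonneg: "(\<And>\<epsilon>. F \<epsilon> \<ge> 0) \<Longrightarrow> sign_mean S F \<ge> 0"
  by (simp add: sign_mean_def sum_nonneg)

lemma sign_mean_const [simp]: "finite S \<Longrightarrow> sign_mean S (\<lambda>_. c) = c"
  by (simp add: sign_mean_def card_signs)

lemma sign_mean_mono:
  "(\<And>\<epsilon>. \<epsilon> \<in> S \<rightarrow>\<^sub>E {-1, 1} \<Longrightarrow> F \<epsilon> \<le> G \<epsilon>) \<Longrightarrow> sign_mean S F \<le> sign_mean S G"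
  unfolding sign_mean_def by (intro divide_right_mono sum_mono) auto

lemma sign_mean_cong:
  "(\<And>\<epsilon>. \<epsilon> \<in> S \<rightarrow>\<^sub>E {-1, 1} \<Longrightarrow> F \<epsilon> = G \<epsilon>) \<Longrightarrow> sign_mean S F = sign_mean S G"
  by (simp add: sign_mean_def cong: sum.cong)

text \<open>The probabilistic method. This lemma and its mirror image make the random choices below
  deterministic: the halving of an index set and the signs of the bilinear form.\<close>

lemma sign_mean_ex_le:
  assumes "finite S" shows "\<exists>\<epsilon>\<in>S \<rightarrow>\<^sub>E {-1, 1}. F \<epsilon> \<le> sign_mean S F"
proof (rule ccontr)
  assume less: "\<not> ?thesis"
  have "(\<Sum>\<epsilon>\<in>S \<rightarrow>\<^sub>E {-1, 1::real}. sign_mean S F) < (\<Sum>\<epsilon>\<in>S \<rightarrow>\<^sub>E {-1, 1}. F \<epsilon>)"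
    by (rule sum_strict_mono) (use assms less in \<open>auto simp: finite_signs PiE_eq_empty_iff\<close>)
  then show False
    using assms by (simp add: card_signs sign_mean_def)
qed

lemma sign_mean_ex_ge:
  assumes "finite S" shows "\<exists>\<epsilon>\<in>S \<rightarrow>\<^sub>E {-1, 1}. sign_mean S F \<le> F \<epsilon>"
  using sign_mean_ex_le[OF assms, of "\<lambda>\<epsilon>. -1 * F \<epsilon>"] unfolding sign_mean_cmult by auto

text \<open>The variance is nonnegative.\<close>

lemma sign_mean_le_sqrt:
  assumes "finite S" shows "sign_mean S F \<le> sqrt (sign_mean S (\<lambda>\<epsilon>. (F \<epsilon>)\<^sup>2))"
proof -
  define m where "m = sign_mean S F"
  have "0 \<le> sign_mean S (\<lambda>\<epsilon>. (F \<epsilon> - m)\<^sup>2)"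
    using sign_mean_mono[of S "\<lambda>_. 0" "\<lambda>\<epsilon>. (F \<epsilon> - m)\<^sup>2"] assms by simp
  also have "\<dots> = sign_mean S (\<lambda>\<epsilon>. ((F \<epsilon>)\<^sup>2 + (- 2 * m) * F \<epsilon>) + m\<^sup>2)"
    by (simp add: power2_diff algebra_simps)
  also have "\<dots> = sign_mean S (\<lambda>\<epsilon>. (F \<epsilon>)\<^sup>2) - m\<^sup>2"
    using assms by (simp only: sign_mean_add sign_mean_cmult sign_mean_const)
      (simp add: m_def power2_eq_square)
  finally show ?thesis
    by (intro real_le_rsqrt) (simp add: m_def)
qed

section \<open>Averages of functions of a random signed sum\<close>

lemma sign_avg_empty [simp]: "sign_avg {} z f = f 0"
  by (simp add: sign_avg_def)

lemma sign_avg_insert: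
  assumes "finite S" "a \<notin> S"
  shows "sign_avg (insert a S) z f = sign_avg S z (\<lambda>v. (f (v + z a) + f (v - z a)) / 2)"
proof -
  have "(\<Sum>i\<in>S. (\<epsilon>(a := c)) i *\<^sub>R z i) = (\<Sum>i\<in>S. \<epsilon> i *\<^sub>R z i)" for \<epsilon> :: "'a \<Rightarrow> real" and c
    using assms by (intro sum.cong) auto
  then show ?thesis
    using assms by (simp add: sign_avg_def sign_mean_insert algebra_simps)
qed

lemma sign_avg_mono: "(\<And>v. f v \<le> g v) \<Longrightarrow> sign_avg S z f \<le> sign_avg S z g"
  by (simp add: sign_avg_def sign_mean_mono)

text \<open>The signs are symmetric: in the induction a flip at \<open>a\<close> only exchanges the
  two terms of \<open>sign_avg_insert\<close>.\<close>

lemma sign_avg_flip: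
  assumes "finite S" "\<And>i. i \<in> S \<Longrightarrow> \<eta> i \<in> {-1, 1}"
  shows "sign_avg S (\<lambda>i. \<eta> i *\<^sub>R z i) f = sign_avg S z f"
  using assms
proof (induction S arbitrary: f rule: finite_induct)
  case (insert a S)
  then have "\<eta> a = 1 \<or> \<eta> a = -1" by auto
  with insert show ?case
    by (auto simp: sign_avg_insert add.commute)
qed simp

lemma sign_avg_reindex:
  assumes "finite S" "inj_on \<pi> S"
  shows "sign_avg (\<pi> ` S) z f = sign_avg S (\<lambda>i. z (\<pi> i)) f"
  using assms
proof (induction S arbitrary: f rule: finite_induct)
  case (insert a S)
  then have "\<pi> a \<notin> \<pi> ` S" by auto
  with insert show ?case by (auto simp: sign_avg_insert)
qed simp

lemma sign_avg_restrict:
  assumes "finite S"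
  shows "sign_avg S (\<lambda>i. if i \<in> D then z i else 0) f = sign_avg (S \<inter> D) z f"
  using assms
proof (induction S arbitrary: f rule: finite_induct)
  case (insert a S)
  then show ?case
    by (cases "a \<in> D") (simp_all add: sign_avg_insert)
qed simp

text \<open>Signs outside \<open>D\<close> multiply zero vectors and average out. Averages over
  different subsets can thus be taken over one common family of signs.\<close>

lemma sign_avg_subset:
  assumes "finite S" "D \<subseteq> S"
  shows "sign_avg D z f = sign_mean S (\<lambda>\<epsilon>. f (\<Sum>i\<in>D. \<epsilon> i *\<^sub>R z i))"
proof -
  have "(\<Sum>i\<in>S. \<epsilon> i *\<^sub>R (if i \<in> D then z i else 0)) = (\<Sum>i\<in>D. \<epsilon> i *\<^sub>R z i)" for \<epsilon> :: "'a \<Rightarrow> real"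
    using assms by (intro sum.mono_neutral_cong_right) auto
  then show ?thesis
    using sign_avg_restrict[OF assms(1), of D z f] assms(2)
    by (simp add: sign_avg_def Int_absorb1)
qed

text \<open>Jensen's inequality: each further index adds an independent symmetric term
  \<open>\<plusminus> z a\<close>, which cannot lower the average of a midpoint convex
  function.\<close>

lemma sign_avg_subset_le:
  assumes "finite S" "D \<subseteq> S" and midconvex: "\<And>v w. f v \<le> (f (v + w) + f (v - w)) / 2"
  shows "sign_avg D z f \<le> sign_avg S z f"
proof -
  have "sign_avg D z f \<le> sign_avg (D \<union> T) z f" if "finite T" "finite D" "D \<inter> T = {}" for T
    using that
  proof (induction T rule: finite_induct)
    case (insert a T)
    have "sign_avg (D \<union> T) z f \<le> sign_avg (D \<union> T) z (\<lambda>v. (f (v + z a) + f (v - z a)) / 2)"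
      by (intro sign_avg_mono midconvex)
    also have "\<dots> = sign_avg (insert a (D \<union> T)) z f"
      using insert by (subst sign_avg_insert) auto
    finally show ?case using insert by auto
  qed simp
  from this[of "S - D"] show ?thesis
    using assms by (auto simp: finite_subset Un_absorb1)
qed

text \<open>Orthonormality of independent signs.\<close>

lemma sign_avg_square:
  fixes t :: "'i \<Rightarrow> real"
  assumes "finite S"
  shows "sign_avg S t (\<lambda>v. v\<^sup>2) = (\<Sum>i\<in>S. (t i)\<^sup>2)"
proof -
  \<comment> \<open>The constant \<open>c\<close> strengthens the induction: averaging over one sign
    turns \<open>v\<^sup>2 + c\<close> into \<open>v\<^sup>2 + ((t a)\<^sup>2 + c)\<close>.\<close>
  have "sign_avg S t (\<lambda>v. v\<^sup>2 + c) = (\<Sum>i\<in>S. (t i)\<^sup>2) + c" for c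
    using assms
  proof (induction S arbitrary: c rule: finite_induct)
    case (insert a S)
    have "(\<lambda>v. ((v + t a)\<^sup>2 + c + ((v - t a)\<^sup>2 + c)) / 2) = (\<lambda>v. v\<^sup>2 + ((t a)\<^sup>2 + c))"
      by (auto simp: power2_eq_square field_simps)
    with insert show ?case by (simp add: sign_avg_insert)
  qed simp
  from this[of 0] show ?thesis by simp
qed

section \<open>Midpoint convexity and Rademacher averages\<close>

lemma norm_midconvex: "norm v \<le> (norm (v + w) + norm (v - w)) / 2"
  for v w :: "'a::real_normed_vector"
  using norm_triangle_ineq[of "v + w" "v - w"] by (simp flip: scaleR_2)

lemma norm_square_midconvex: "(norm v)\<^sup>2 \<le> ((norm (v + w))\<^sup>2 + (norm (v - w))\<^sup>2) / 2"
  for v w :: "'a::real_normed_vector"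
proof -
  have "(norm v)\<^sup>2 \<le> ((norm (v + w) + norm (v - w)) / 2)\<^sup>2"
    by (intro power_mono norm_midconvex) simp
  also have "\<dots> \<le> ((norm (v + w))\<^sup>2 + (norm (v - w))\<^sup>2) / 2"
    using zero_le_power2[of "norm (v + w) - norm (v - w)"]
    by (simp add: power2_eq_square field_simps)
  finally show ?thesis .
qed

lemma rad_mono: "finite S \<Longrightarrow> D \<subseteq> S \<Longrightarrow> rad D z \<le> rad S z"
  unfolding rad_def by (intro real_sqrt_le_mono sign_avg_subset_le norm_square_midconvex)

lemma rad_singleton: "rad {i} z = norm (z i)"
  by (simp add: rad_def sign_avg_insert norm_minus_commute)

lemma norm_le_rad: "finite S \<Longrightarrow> i \<in> S \<Longrightarrow> norm (z i) \<le> rad S z"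
  using rad_mono[of S "{i}" z] by (simp add: rad_singleton)

lemma rad_nonneg [simp]: "rad S z \<ge> 0"
  unfolding rad_def sign_avg_def by (simp add: sign_mean_nonneg)

lemma rad_square: "(rad S z)\<^sup>2 = sign_mean S (\<lambda>\<epsilon>. (norm (\<Sum>i\<in>S. \<epsilon> i *\<^sub>R z i))\<^sup>2)"
  unfolding rad_def sign_avg_def by (rule real_sqrt_pow2) (simp add: sign_mean_nonneg)

lemma rad_scaleR: "rad S (\<lambda>i. c *\<^sub>R z i) = \<bar>c\<bar> * rad S z"
proof -
  have "(\<Sum>i\<in>S. \<epsilon> i *\<^sub>R c *\<^sub>R z i) = c *\<^sub>R (\<Sum>i\<in>S. \<epsilon> i *\<^sub>R z i)" for \<epsilon> :: "'a \<Rightarrow> real"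
    by (simp add: scaleR_sum_right mult.commute)
  then show ?thesis
    by (simp add: rad_def sign_avg_def power_mult_distrib sign_mean_cmult real_sqrt_mult)
qed

subsection \<open>Contraction and halving\<close>

lemma bounded_cmult_image:
  fixes f :: "'g \<Rightarrow> real"
  assumes "bounded (f ` G)" shows "bounded ((\<lambda>g. c * f g) ` G)"
  using bounded_scaling[OF assms, of c] by (simp add: image_image)

text \<open>For two points \<open>g\<close>, \<open>g'\<close> the difference
  \<open>w g - w g'\<close> is at most \<open>\<bar>v g - v g'\<bar>\<close>. According to the sign
  of \<open>v g - v g'\<close>, the point \<open>g\<close> is then used in the supremum with
  \<open>+ v\<close> and \<open>g'\<close> in the one with \<open>- v\<close>, or vice
  versa.\<close>

lemma SUP_contraction_pair:
  fixes h w v :: "'g \<Rightarrow> real"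
  assumes "G \<noteq> {}" "bounded (h ` G)" "bounded (v ` G)"
    and contr: "\<And>g g'. g \<in> G \<Longrightarrow> g' \<in> G \<Longrightarrow> \<bar>w g - w g'\<bar> \<le> \<bar>v g - v g'\<bar>"
  shows "(SUP g\<in>G. h g + w g) + (SUP g\<in>G. h g - w g)
    \<le> (SUP g\<in>G. h g + v g) + (SUP g\<in>G. h g - v g)" (is "_ \<le> ?R")
proof -
  have b: "bdd_above ((\<lambda>g. h g + v g) ` G)" "bdd_above ((\<lambda>g. h g - v g) ` G)"
    using assms(2,3) by (auto intro!: bounded_imp_bdd_above bounded_plus_comp bounded_minus_comp)
  have le: "h g + w g + (h g' - w g') \<le> ?R" if "g \<in> G" "g' \<in> G" for g g'
  proof -
    have "h g + v g \<le> (SUP g\<in>G. h g + v g)" "h g' + v g' \<le> (SUP g\<in>G. h g + v g)"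
      "h g - v g \<le> (SUP g\<in>G. h g - v g)" "h g' - v g' \<le> (SUP g\<in>G. h g - v g)"
      using that by (auto intro!: cSUP_upper b)
    then show ?thesis using contr[OF that] by linarith
  qed
  have "(SUP g\<in>G. h g + w g) \<le> ?R - (h g' - w g')" if "g' \<in> G" for g'
    using le[OF _ that] assms(1) by (intro cSUP_least) (auto simp: algebra_simps)
  then have "(SUP g\<in>G. h g - w g) \<le> ?R - (SUP g\<in>G. h g + w g)"
    using assms(1) by (intro cSUP_least) (auto simp: algebra_simps)
  then show ?thesis by simp
qed

text \<open>The Ledoux--Talagrand comparison principle. The term \<open>h\<close> makes the induction on \<open>S\<close> work.\<close>

lemma sign_mean_SUP_contraction:
  fixes h :: "'g \<Rightarrow> real" and v w :: "'i \<Rightarrow> 'g \<Rightarrow> real"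
  assumes "finite S" "G \<noteq> {}" "bounded (h ` G)"
    and "\<And>i. i \<in> S \<Longrightarrow> bounded (v i ` G)" "\<And>i. i \<in> S \<Longrightarrow> bounded (w i ` G)"
    and "\<And>i g g'. i \<in> S \<Longrightarrow> g \<in> G \<Longrightarrow> g' \<in> G \<Longrightarrow> \<bar>w i g - w i g'\<bar> \<le> \<bar>v i g - v i g'\<bar>"
  shows "sign_mean S (\<lambda>\<epsilon>. SUP g\<in>G. h g + (\<Sum>i\<in>S. \<epsilon> i * w i g))
    \<le> sign_mean S (\<lambda>\<epsilon>. SUP g\<in>G. h g + (\<Sum>i\<in>S. \<epsilon> i * v i g))"
  using assms(1,3-)
proof (induction S arbitrary: h rule: finite_induct)
  case (insert a S)
  have upd: "(\<Sum>i\<in>insert a S. (\<epsilon>(a := c)) i * u i g) = c * u a g + (\<Sum>i\<in>S. \<epsilon> i * u i g)"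
    for \<epsilon> c and u :: "'i \<Rightarrow> 'g \<Rightarrow> real" and g
  proof -
    have "(\<Sum>i\<in>S. (\<epsilon>(a := c)) i * u i g) = (\<Sum>i\<in>S. \<epsilon> i * u i g)"
      using insert.hyps by (intro sum.cong) auto
    then show ?thesis using insert.hyps by simp
  qed
  have "sign_mean (insert a S) (\<lambda>\<epsilon>. SUP g\<in>G. h g + (\<Sum>i\<in>insert a S. \<epsilon> i * w i g)) =
      sign_mean S (\<lambda>\<epsilon>. ((SUP g\<in>G. (h g + (\<Sum>i\<in>S. \<epsilon> i * w i g)) + w a g)
        + (SUP g\<in>G. (h g + (\<Sum>i\<in>S. \<epsilon> i * w i g)) - w a g)) / 2)"
    unfolding sign_mean_insert[OF insert.hyps] upd by (simp add: algebra_simps)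
  \<comment> \<open>The sum over the old indices is counted as part of \<open>h\<close>, so that
    only the term of index \<open>a\<close> is exchanged.\<close>
  also have "\<dots> \<le> sign_mean S (\<lambda>\<epsilon>. ((SUP g\<in>G. (h g + (\<Sum>i\<in>S. \<epsilon> i * w i g)) + v a g)
        + (SUP g\<in>G. (h g + (\<Sum>i\<in>S. \<epsilon> i * w i g)) - v a g)) / 2)"
  proof (intro sign_mean_mono divide_right_mono SUP_contraction_pair assms(2))
    fix \<epsilon> :: "'i \<Rightarrow> real"
    have "bounded ((\<lambda>g. \<Sum>i\<in>S. \<epsilon> i * w i g) ` G)"
      using insert.hyps(1) insert.prems(3)
    proof (induction S rule: finite_induct)
      case (insert b S)
      then show ?case
        by (auto intro!: bounded_plus_comp bounded_cmult_image)
    qed (auto simp: bounded_iff)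
    then show "bounded ((\<lambda>g. h g + (\<Sum>i\<in>S. \<epsilon> i * w i g)) ` G)"
      using insert.prems(1) by (rule bounded_plus_comp[rotated])
  qed (use insert.prems in auto)
  also have "\<dots> = (sign_mean S (\<lambda>\<epsilon>. SUP g\<in>G. (h g + v a g) + (\<Sum>i\<in>S. \<epsilon> i * w i g))
      + sign_mean S (\<lambda>\<epsilon>. SUP g\<in>G. (h g - v a g) + (\<Sum>i\<in>S. \<epsilon> i * w i g))) / 2"
    by (simp add: sign_mean_half sign_mean_add algebra_simps)
  \<comment> \<open>Now \<open>h \<plusminus> v a\<close> plays the role of \<open>h\<close> in the
    induction hypothesis.\<close>
  also have "\<dots> \<le> (sign_mean S (\<lambda>\<epsilon>. SUP g\<in>G. (h g + v a g) + (\<Sum>i\<in>S. \<epsilon> i * v i g))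
      + sign_mean S (\<lambda>\<epsilon>. SUP g\<in>G. (h g - v a g) + (\<Sum>i\<in>S. \<epsilon> i * v i g))) / 2"
    using insert.prems
    by (intro divide_right_mono add_mono insert.IH bounded_plus_comp bounded_minus_comp) auto
  also have "\<dots> = sign_mean (insert a S) (\<lambda>\<epsilon>. SUP g\<in>G. h g + (\<Sum>i\<in>insert a S. \<epsilon> i * v i g))"
    unfolding sign_mean_insert[OF insert.hyps] upd
    by (simp add: sign_mean_half sign_mean_add algebra_simps)
  finally show ?case .
qed simp

section \<open>Weak l1-sums of finite families\<close>

definition real_dual_ball :: "('a::real_normed_vector \<Rightarrow> real) set" where
  "real_dual_ball = {g. linear g \<and> (\<forall>x. \<bar>g x\<bar> \<le> norm x)}"

text \<open>This is \<open>\<omega>\<^sub>1\<close> of a finite family for real scalars. Complex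
  functionals are later split into real and imaginary parts, at the cost of a factor 2.\<close>

definition weak_sum :: "'i set \<Rightarrow> ('i \<Rightarrow> 'a::real_normed_vector) \<Rightarrow> real" where
  "weak_sum D z = (SUP g\<in>real_dual_ball. \<Sum>i\<in>D. \<bar>g (z i)\<bar>)"

lemma zero_in_real_dual_ball: "(\<lambda>_. 0) \<in> real_dual_ball"
  by (simp add: real_dual_ball_def linear_iff)

lemma real_dual_ball_nonempty: "real_dual_ball \<noteq> {}"
  using zero_in_real_dual_ball by blast

lemma bounded_real_dual_ball_eval: "bounded ((\<lambda>g. g x) ` real_dual_ball)"
  by (auto simp: real_dual_ball_def bounded_iff)

lemma weak_sum_upper:
  assumes "g \<in> real_dual_ball" shows "(\<Sum>i\<in>D. \<bar>g (z i)\<bar>) \<le> weak_sum D z"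
  unfolding weak_sum_def
proof (rule cSUP_upper[OF assms])
  show "bdd_above ((\<lambda>g. \<Sum>i\<in>D. \<bar>g (z i)\<bar>) ` real_dual_ball)"
    by (rule bdd_aboveI2[where M = "\<Sum>i\<in>D. norm (z i)"], rule sum_mono)
      (simp add: real_dual_ball_def)
qed

lemma weak_sum_least:
  "(\<And>g. g \<in> real_dual_ball \<Longrightarrow> (\<Sum>i\<in>D. \<bar>g (z i)\<bar>) \<le> B) \<Longrightarrow> weak_sum D z \<le> B"
  unfolding weak_sum_def by (rule cSUP_least[OF real_dual_ball_nonempty])

lemma SUP_signed_abs_upper:
  assumes "finite D" "g \<in> real_dual_ball"
  shows "(\<Sum>i\<in>D. \<epsilon> i * (s * \<bar>g (z i)\<bar>)) \<le> (SUP g\<in>real_dual_ball. \<Sum>i\<in>D. \<epsilon> i * (s * \<bar>g (z i)\<bar>))"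
proof (rule cSUP_upper[OF assms(2)])
  show "bdd_above ((\<lambda>g. \<Sum>i\<in>D. \<epsilon> i * (s * \<bar>g (z i)\<bar>)) ` real_dual_ball)"
  proof (rule bdd_aboveI2[where M = "\<Sum>i\<in>D. \<bar>\<epsilon> i * s\<bar> * norm (z i)"], rule sum_mono)
    fix g :: "'b \<Rightarrow> real" and i assume g: "g \<in> real_dual_ball"
    have "\<epsilon> i * (s * \<bar>g (z i)\<bar>) \<le> \<bar>\<epsilon> i * s\<bar> * \<bar>g (z i)\<bar>"
      using abs_ge_self[of "\<epsilon> i * (s * \<bar>g (z i)\<bar>)"] by (simp add: abs_mult mult.assoc)
    also have "\<dots> \<le> \<bar>\<epsilon> i * s\<bar> * norm (z i)"
      using g by (intro mult_left_mono) (auto simp: real_dual_ball_def)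
    finally show "\<epsilon> i * (s * \<bar>g (z i)\<bar>) \<le> \<bar>\<epsilon> i * s\<bar> * norm (z i)" .
  qed
qed

text \<open>The map \<open>t \<mapsto> s * \<bar>t\<bar>\<close> is 1-Lipschitz, so the contraction
  principle removes the absolute values. By linearity the remaining signed sum is \<open>g\<close>
  of the random vector, hence at most its norm.\<close>

lemma sign_mean_SUP_abs_le:
  fixes z :: "'i \<Rightarrow> 'a::real_normed_vector"
  assumes "finite D" "\<bar>s\<bar> = 1"
  shows "sign_mean D (\<lambda>\<epsilon>. SUP g\<in>real_dual_ball. \<Sum>i\<in>D. \<epsilon> i * (s * \<bar>g (z i)\<bar>)) \<le> sign_avg D z norm"
proof -
  let ?G = "real_dual_ball :: ('a \<Rightarrow> real) set"
  have "sign_mean D (\<lambda>\<epsilon>. SUP g\<in>?G. 0 + (\<Sum>i\<in>D. \<epsilon> i * (s * \<bar>g (z i)\<bar>)))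
      \<le> sign_mean D (\<lambda>\<epsilon>. SUP g\<in>?G. 0 + (\<Sum>i\<in>D. \<epsilon> i * g (z i)))"
  proof (rule sign_mean_SUP_contraction[OF assms(1) real_dual_ball_nonempty])
    show "bounded ((\<lambda>g. s * \<bar>g (z i)\<bar>) ` ?G)" for i
      using assms(2) by (auto simp: real_dual_ball_def bounded_iff abs_mult)
    show "\<bar>s * \<bar>g (z i)\<bar> - s * \<bar>g' (z i)\<bar>\<bar> \<le> \<bar>g (z i) - g' (z i)\<bar>" for i and g g' :: "'a \<Rightarrow> real"
      using assms(2) by (simp flip: right_diff_distrib add: abs_mult)
    show "bounded ((\<lambda>_. 0 :: real) ` ?G)" by (auto simp: bounded_iff)
    show "bounded ((\<lambda>g. g (z i)) ` ?G)" for i by (rule bounded_real_dual_ball_eval)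
  qed
  also have "\<dots> \<le> sign_avg D z norm"
    unfolding sign_avg_def
  proof (intro sign_mean_mono cSUP_least real_dual_ball_nonempty)
    fix \<epsilon> g assume "g \<in> ?G"
    then have g: "linear g" "\<bar>g x\<bar> \<le> norm x" for x by (auto simp: real_dual_ball_def)
    have "0 + (\<Sum>i\<in>D. \<epsilon> i * g (z i)) = g (\<Sum>i\<in>D. \<epsilon> i *\<^sub>R z i)"
      by (simp add: linear_sum[OF g(1)] linear_scale[OF g(1)])
    also have "\<dots> \<le> norm (\<Sum>i\<in>D. \<epsilon> i *\<^sub>R z i)"
      using g(2) abs_le_D1 by blast
    finally show "0 + (\<Sum>i\<in>D. \<epsilon> i * g (z i)) \<le> norm (\<Sum>i\<in>D. \<epsilon> i *\<^sub>R z i)" .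
  qed
  finally show ?thesis by simp
qed

text \<open>The points are paired by \<open>\<pi>\<close>, and a random sign decides which point of
  each pair goes to \<open>E\<close>. The value \<open>\<bar>g\<bar>\<close> at a chosen point is
  half the total of its pair plus half a signed difference. The totals add up to at most
  \<open>weak_sum D z\<close>, and the signed parts are fluctuations bounded by
  \<open>sign_mean_SUP_abs_le\<close>.\<close>

lemma exists_weak_sum_halving:
  fixes z :: "'i \<Rightarrow> 'a::real_normed_vector"
  assumes "finite D" "card D = 2 * k"
  shows "\<exists>E\<subseteq>D. card E = k \<and> weak_sum E z + weak_sum (D - E) z \<le> weak_sum D z + 2 * sign_avg D z norm"
proof -
  obtain D1 where D1: "D1 \<subseteq> D" "card D1 = k"
    using obtain_subset_with_card_n[of k D] assms(2) by auto
  then have fin: "finite D1" "finite (D - D1)" using finite_subset[OF D1(1) assms(1)] assms(1) by simp_all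
  have "card (D - D1) = k"
    using D1 assms by (simp add: card_Diff_subset fin)
  then obtain \<pi> where \<pi>: "bij_betw \<pi> D1 (D - D1)"
    using finite_same_card_bij[OF fin] D1 by auto
  then have inj: "inj_on \<pi> D1" and im: "\<pi> ` D1 = D - D1" by (auto simp: bij_betw_def)
  define keep where "keep \<epsilon> i = (if \<epsilon> i = (1::real) then i else \<pi> i)" for \<epsilon> i
  define drop where "drop \<epsilon> i = (if \<epsilon> i = (1::real) then \<pi> i else i)" for \<epsilon> i
  have \<pi>_mem: "\<pi> i \<in> D - D1" if "i \<in> D1" for i using im that by blast
  have nm: "\<pi> i \<notin> D1" if "i \<in> D1" for i
    using \<pi>_mem[OF that] by simp
  have ne: "\<pi> i \<noteq> j" "j \<noteq> \<pi> i" and eq: "\<pi> i = \<pi> j \<longleftrightarrow> i = j" if "i \<in> D1" "j \<in> D1" for i j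
    using that \<pi>_mem[of i] inj_on_eq_iff[OF inj] by auto
  have inj_keep: "inj_on (keep \<epsilon>) D1" and inj_drop: "inj_on (drop \<epsilon>) D1" for \<epsilon>
    by (auto intro!: inj_onI simp: keep_def drop_def eq ne nm split: if_splits)
  have sub: "keep \<epsilon> ` D1 \<subseteq> D" for \<epsilon>
    using D1 \<pi>_mem by (auto simp: keep_def)
  have compl: "D - keep \<epsilon> ` D1 = drop \<epsilon> ` D1" for \<epsilon>
  proof -
    have "keep \<epsilon> ` D1 \<inter> drop \<epsilon> ` D1 = {}"
      by (auto simp: keep_def drop_def eq nm split: if_splits)
    moreover have "keep \<epsilon> ` D1 \<union> drop \<epsilon> ` D1 = D"
    proof -
      have "keep \<epsilon> ` D1 \<union> drop \<epsilon> ` D1 = (\<Union>i\<in>D1. {keep \<epsilon> i, drop \<epsilon> i})"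
        by blast
      also have "\<dots> = (\<Union>i\<in>D1. {i, \<pi> i})"
        by (rule SUP_cong) (simp_all add: keep_def drop_def insert_commute)
      also have "\<dots> = D1 \<union> \<pi> ` D1" by blast
      also have "\<dots> = D" unfolding im using D1(1) by blast
      finally show ?thesis .
    qed
    ultimately show ?thesis by blast
  qed
  define P where "P s y \<epsilon> = (SUP g\<in>real_dual_ball. \<Sum>i\<in>D1. \<epsilon> i * (s * \<bar>g (y i)\<bar>))"
    for s :: real and y :: "'i \<Rightarrow> 'a" and \<epsilon>
  let ?y = "\<lambda>i. z (\<pi> i)"
  have split: "(\<Sum>i\<in>D. \<bar>g (z i)\<bar>) = (\<Sum>i\<in>D1. \<bar>g (z i)\<bar> + \<bar>g (?y i)\<bar>)" for g :: "'a \<Rightarrow> real"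
  proof -
    have "(\<Sum>i\<in>D. \<bar>g (z i)\<bar>) = (\<Sum>i\<in>D1. \<bar>g (z i)\<bar>) + (\<Sum>i\<in>D - D1. \<bar>g (z i)\<bar>)"
      by (subst sum.subset_diff[OF D1(1) assms(1)]) simp
    also have "(\<Sum>i\<in>D - D1. \<bar>g (z i)\<bar>) = (\<Sum>i\<in>D1. \<bar>g (?y i)\<bar>)"
      unfolding im[symmetric] by (simp add: sum.reindex[OF inj])
    finally show ?thesis by (simp add: sum.distrib)
  qed
  \<comment> \<open>One estimate for both halves: \<open>s\<close> is 1 for \<open>keep\<close> and
    -1 for \<open>drop\<close>.\<close>
  have bound: "weak_sum (f ` D1) z \<le> (weak_sum D z + P s z \<epsilon> + P (- s) ?y \<epsilon>) / 2"
    if f: "inj_on f D1"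
      "\<And>i g. i \<in> D1 \<Longrightarrow> 2 * \<bar>g (z (f i))\<bar> =
        (\<bar>g (z i)\<bar> + \<bar>g (?y i)\<bar>) + \<epsilon> i * (s * \<bar>g (z i)\<bar>) + \<epsilon> i * (- s * \<bar>g (?y i)\<bar>)"
    for f \<epsilon> and s :: real
  proof (rule weak_sum_least)
    fix g :: "'a \<Rightarrow> real" assume g: "g \<in> real_dual_ball"
    have "2 * (\<Sum>i\<in>f ` D1. \<bar>g (z i)\<bar>) = (\<Sum>i\<in>D1. 2 * \<bar>g (z (f i))\<bar>)"
      by (simp add: sum.reindex[OF f(1)] sum_distrib_left)
    also have "\<dots> = (\<Sum>i\<in>D. \<bar>g (z i)\<bar>) + (\<Sum>i\<in>D1. \<epsilon> i * (s * \<bar>g (z i)\<bar>))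
        + (\<Sum>i\<in>D1. \<epsilon> i * (- s * \<bar>g (?y i)\<bar>))"
      using f(2) by (simp only: split sum.distrib cong: sum.cong)
    also have "\<dots> \<le> weak_sum D z + P s z \<epsilon> + P (- s) ?y \<epsilon>"
      unfolding P_def by (intro add_mono weak_sum_upper SUP_signed_abs_upper fin g)
    finally show "(\<Sum>i\<in>f ` D1. \<bar>g (z i)\<bar>) \<le> (weak_sum D z + P s z \<epsilon> + P (- s) ?y \<epsilon>) / 2"
      by simp
  qed
  let ?W = "\<lambda>\<epsilon>. weak_sum (keep \<epsilon> ` D1) z + weak_sum (drop \<epsilon> ` D1) z"
  have "sign_mean D1 ?W \<le> sign_mean D1 (\<lambda>\<epsilon>. weak_sum D z
      + (P 1 z \<epsilon> + P (-1) ?y \<epsilon> + (P (-1) z \<epsilon> + P 1 ?y \<epsilon>)) / 2)"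
  proof (rule sign_mean_mono)
    fix \<epsilon> :: "'i \<Rightarrow> real" assume "\<epsilon> \<in> D1 \<rightarrow>\<^sub>E {-1, 1}"
    then have \<epsilon>: "\<epsilon> i = -1 \<or> \<epsilon> i = 1" if "i \<in> D1" for i using that by auto
    have "weak_sum (keep \<epsilon> ` D1) z \<le> (weak_sum D z + P 1 z \<epsilon> + P (- 1) ?y \<epsilon>) / 2"
      by (rule bound[OF inj_keep]) (drule \<epsilon>, auto simp: keep_def)
    moreover have "weak_sum (drop \<epsilon> ` D1) z \<le> (weak_sum D z + P (-1) z \<epsilon> + P (- (-1)) ?y \<epsilon>) / 2"
      by (rule bound[OF inj_drop]) (drule \<epsilon>, auto simp: drop_def)
    ultimately show "?W \<epsilon> \<le> weak_sum D z
      + (P 1 z \<epsilon> + P (-1) ?y \<epsilon> + (P (-1) z \<epsilon> + P 1 ?y \<epsilon>)) / 2"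
      by (simp add: field_simps)
  qed
  also have "\<dots> = weak_sum D z + (sign_mean D1 (P 1 z) + sign_mean D1 (P (-1) ?y)
      + (sign_mean D1 (P (-1) z) + sign_mean D1 (P 1 ?y))) / 2"
    using fin by (simp add: sign_mean_add sign_mean_half)
  also have "\<dots> \<le> weak_sum D z + (sign_avg D1 z norm + sign_avg D1 ?y norm
      + (sign_avg D1 z norm + sign_avg D1 ?y norm)) / 2"
    unfolding P_def
    by (intro add_left_mono divide_right_mono add_mono sign_mean_SUP_abs_le fin) auto
  \<comment> \<open>Half the sum of the four averages is one average for \<open>D1\<close> plus one
    for \<open>D - D1\<close>; each is at most the average for \<open>D\<close>.\<close>
  also have "\<dots> \<le> weak_sum D z + 2 * sign_avg D z norm"
    using sign_avg_subset_le[OF assms(1) D1(1) norm_midconvex, of z]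
      sign_avg_subset_le[OF assms(1) Diff_subset norm_midconvex, of D1 z]
      sign_avg_reindex[OF fin(1) inj, of z norm] unfolding im by (simp add: field_simps)
  finally have "sign_mean D1 ?W \<le> weak_sum D z + 2 * sign_avg D z norm" .
  then obtain \<epsilon> where "?W \<epsilon> \<le> weak_sum D z + 2 * sign_avg D z norm"
    using sign_mean_ex_le[OF fin(1), of ?W] by (meson order_trans)
  then show ?thesis
    using sub[of \<epsilon>] card_image[OF inj_keep[of \<epsilon>]] D1(2) compl[of \<epsilon>]
    by (intro exI[of _ "keep \<epsilon> ` D1"]) simp
qed

section \<open>Repeated halving\<close>

lemma sum_lessThan_double: "(\<Sum>b<2 * m. f b) = (\<Sum>b<m. f (2 * b) + f (2 * b + 1))"
  for f :: "nat \<Rightarrow> 'a::comm_monoid_add"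
  by (induction m) (simp_all add: algebra_simps)

text \<open>Halving all \<open>2 ^ j\<close> parts of level \<open>j\<close> costs twice the sum of
  their averages, and \<open>X j\<close> bounds that sum for any disjoint parts, so the choices made
  earlier do not matter.\<close>

lemma exists_weak_sum_partition:
  fixes z :: "'i \<Rightarrow> 'a::real_normed_vector" and X :: "nat \<Rightarrow> real"
  assumes "finite S" "card S = 2 ^ N" "p \<le> N"
    and X: "\<And>j (D :: nat \<Rightarrow> 'i set). disjoint_family_on D {..<2 ^ j} \<Longrightarrow> (\<And>b. b < 2 ^ j \<Longrightarrow> D b \<subseteq> S) \<Longrightarrow>
      (\<Sum>b<2 ^ j. sign_avg (D b) z norm) \<le> X j"
  shows "\<exists>D :: nat \<Rightarrow> 'i set. disjoint_family_on D {..<2 ^ p} \<and> (\<forall>b<2 ^ p. D b \<subseteq> S \<and> card (D b) = 2 ^ (N - p))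
    \<and> (\<Sum>b<2 ^ p. weak_sum (D b) z) \<le> weak_sum S z + 2 * (\<Sum>j<p. X j)"
  using assms(3)
proof (induction p)
  case 0
  then show ?case
    using assms(2) by (intro exI[of _ "\<lambda>_. S"]) (auto simp: disjoint_family_on_def)
next
  case (Suc p)
  then obtain D :: "nat \<Rightarrow> 'i set" where D: "disjoint_family_on D {..<2 ^ p}"
    "\<And>b. b < 2 ^ p \<Longrightarrow> D b \<subseteq> S" "\<And>b. b < 2 ^ p \<Longrightarrow> card (D b) = 2 ^ (N - p)"
    "(\<Sum>b<2 ^ p. weak_sum (D b) z) \<le> weak_sum S z + 2 * (\<Sum>j<p. X j)"
    by auto
  have "\<exists>E\<subseteq>D b. card E = 2 ^ (N - Suc p) \<and>
      weak_sum E z + weak_sum (D b - E) z \<le> weak_sum (D b) z + 2 * sign_avg (D b) z norm"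
    if "b < 2 ^ p" for b
  proof (rule exists_weak_sum_halving)
    show "finite (D b)" using D(2)[OF that] assms(1) finite_subset by blast
    show "card (D b) = 2 * 2 ^ (N - Suc p)"
      using D(3)[OF that] Suc.prems by (simp flip: power_Suc add: Suc_diff_Suc)
  qed
  then obtain E where E: "\<And>b. b < 2 ^ p \<Longrightarrow> E b \<subseteq> D b" "\<And>b. b < 2 ^ p \<Longrightarrow> card (E b) = 2 ^ (N - Suc p)"
    "\<And>b. b < 2 ^ p \<Longrightarrow> weak_sum (E b) z + weak_sum (D b - E b) z \<le> weak_sum (D b) z + 2 * sign_avg (D b) z norm"
    by metis
  \<comment> \<open>Part \<open>b\<close> splits into the parts \<open>2 * b\<close> and
    \<open>2 * b + 1\<close>, so \<open>b div 2\<close> is the parent of \<open>b\<close>.\<close>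
  define D' where "D' (b::nat) = (if even b then E (b div 2) else D (b div 2) - E (b div 2))" for b
  have sub: "D' b \<subseteq> D (b div 2)" if "b < 2 ^ Suc p" for b
    using E(1)[of "b div 2"] that by (auto simp: D'_def)
  have "disjoint_family_on D' {..<2 ^ Suc p}"
    unfolding disjoint_family_on_def
  proof (intro ballI impI)
    fix b c :: nat assume bc: "b \<in> {..<2 ^ Suc p}" "c \<in> {..<2 ^ Suc p}" "b \<noteq> c"
    show "D' b \<inter> D' c = {}"
    proof (cases "b div 2 = c div 2")
      case True
      then have "even b \<noteq> even c" using bc(3) by presburger
      then show ?thesis using True by (auto simp: D'_def)
    next
      case False
      then have "D (b div 2) \<inter> D (c div 2) = {}"
        using D(1) bc by (auto simp: disjoint_family_on_def)
      then show ?thesis using sub[of b] sub[of c] bc by auto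
    qed
  qed
  moreover have "D' b \<subseteq> S \<and> card (D' b) = 2 ^ (N - Suc p)" if "b < 2 ^ Suc p" for b
  proof -
    have b: "b div 2 < 2 ^ p" using that by auto
    have "card (D (b div 2) - E (b div 2)) = 2 ^ (N - p) - 2 ^ (N - Suc p)"
      using E(1,2)[OF b] D(2,3)[OF b] assms(1) by (metis card_Diff_subset finite_subset)
    also have "\<dots> = (2::nat) ^ (N - Suc p)"
    proof -
      have "N - p = Suc (N - Suc p)" using Suc.prems by simp
      then show ?thesis by simp
    qed
    finally show ?thesis
      using sub[OF that] D(2)[OF b] E(2)[OF b] by (auto simp: D'_def)
  qed
  moreover have "(\<Sum>b<2 ^ Suc p. weak_sum (D' b) z) \<le> weak_sum S z + 2 * (\<Sum>j<Suc p. X j)"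
  proof -
    have "(\<Sum>b<2 ^ Suc p. weak_sum (D' b) z) = (\<Sum>b<2 ^ p. weak_sum (E b) z + weak_sum (D b - E b) z)"
      by (simp add: sum_lessThan_double D'_def)
    also have "\<dots> \<le> (\<Sum>b<2 ^ p. weak_sum (D b) z + 2 * sign_avg (D b) z norm)"
      by (intro sum_mono E(3)) simp
    also have "\<dots> = (\<Sum>b<2 ^ p. weak_sum (D b) z) + 2 * (\<Sum>b<2 ^ p. sign_avg (D b) z norm)"
      by (simp add: sum.distrib sum_distrib_left)
    also have "\<dots> \<le> weak_sum S z + 2 * (\<Sum>j<p. X j) + 2 * X p"
      using X[OF D(1,2)] D(4) by simp
    finally show ?thesis by simp
  qed
  ultimately show ?case by blast
qed

subsection \<open>Consequences and failure of cotype\<close>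

text \<open>Hoelder's inequality against the constant 1, by summing Young's inequality for
  normalised values.\<close>

lemma sum_le_power_mean:
  fixes x :: "'i \<Rightarrow> real"
  assumes "finite S" "q > 1" "\<And>i. i \<in> S \<Longrightarrow> x i \<ge> 0"
  shows "(\<Sum>i\<in>S. x i) \<le> real (card S) powr (1 - 1 / q) * (\<Sum>i\<in>S. x i powr q) powr (1 / q)"
proof (cases "(\<Sum>i\<in>S. x i powr q) = 0")
  case True
  then have "x i = 0" if "i \<in> S" for i
    using assms(1) that by (auto simp: sum_nonneg_eq_0_iff)
  then show ?thesis by simp
next
  case False
  define s where "s = (\<Sum>i\<in>S. x i powr q) powr (1 / q)"
  define n where "n = real (card S)"
  have S: "S \<noteq> {}" using False by auto
  have pos: "(\<Sum>i\<in>S. x i powr q) > 0"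
    using False by (simp add: order_less_le sum_nonneg)
  then have s: "s > 0" and sq: "s powr q = (\<Sum>i\<in>S. x i powr q)"
    using assms(2) by (auto simp: s_def powr_powr)
  have n: "n > 0" using S assms(1) by (simp add: n_def card_gt_0_iff)
  define q' where "q' = q / (q - 1)"
  have q': "q' > 1" "1 / q + 1 / q' = 1"
    using assms(2) by (auto simp: q'_def field_simps)
  \<comment> \<open>Summed over \<open>S\<close>, the right-hand side becomes
    \<open>1 / q + 1 / q' = 1\<close>.\<close>
  have "x i / s * n powr (- 1 / q') \<le> x i powr q / s powr q / q + 1 / n / q'" if "i \<in> S" for i
  proof -
    have "x i / s * n powr (- 1 / q') \<le> (x i / s) powr q / q + (n powr (- 1 / q')) powr q' / q'"
      using s assms(3)[OF that] assms(2) q' by (intro Youngs_inequality) auto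
    also have "(n powr (- 1 / q')) powr q' = 1 / n"
      using q'(1) n by (subst powr_powr) (simp add: powr_minus_divide)
    also have "(x i / s) powr q = x i powr q / s powr q"
      using s assms(3)[OF that] by (simp add: powr_divide)
    finally show ?thesis .
  qed
  then have "(\<Sum>i\<in>S. x i / s * n powr (- 1 / q')) \<le> (\<Sum>i\<in>S. x i powr q / s powr q / q + 1 / n / q')"
    by (rule sum_mono)
  also have "\<dots> = (\<Sum>i\<in>S. x i powr q) / s powr q / q + n * (1 / n / q')"
    by (simp add: sum.distrib sum_divide_distrib n_def)
  also have "\<dots> = 1"
    using pos n q' by (simp add: sq)
  finally have "(\<Sum>i\<in>S. x i) / s * n powr (- 1 / q') \<le> 1"
    by (simp add: sum_divide_distrib sum_distrib_right)
  then have "(\<Sum>i\<in>S. x i) \<le> s * n powr (1 / q')"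
    using s n by (simp add: powr_minus field_simps)
  moreover have "1 / q' = 1 - 1 / q" using q'(2) by linarith
  ultimately have "(\<Sum>i\<in>S. x i) \<le> s * n powr (1 - 1 / q)" by metis
  then show ?thesis by (simp add: s_def n_def mult.commute)
qed

text \<open>The only form in which cotype enters as an upper bound. For
  \<open>q = \<infinity>\<close> the value of \<open>1 / real_of_ereal q\<close> is
  \<open>1 / 0 = 0\<close>, so the exponent is 1, as it should be.\<close>

lemma has_cotype_sum_norm_le:
  assumes "has_cotype TYPE('a::real_normed_vector) q"
  shows "\<exists>K>0. \<forall>n (x :: nat \<Rightarrow> 'a).
    (\<Sum>i<n. norm (x i)) \<le> K * real n powr (1 - 1 / real_of_ereal q) * rad {..<n} x"
proof -
  obtain C where q: "2 \<le> q" and C: "\<And>n (x :: nat \<Rightarrow> 'a).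
    if q = \<infinity> then (\<forall>i<n. norm (x i) \<le> C * rad {..<n} x)
    else (\<Sum>i<n. norm (x i) powr real_of_ereal q) powr (1 / real_of_ereal q) \<le> C * rad {..<n} x"
    using assms unfolding has_cotype_def rademacher_average_eq_rad by blast
  have "(\<Sum>i<n. norm (x i)) \<le> max 1 C * real n powr (1 - 1 / real_of_ereal q) * rad {..<n} x"
    for n and x :: "nat \<Rightarrow> 'a"
  proof (cases "q = \<infinity>")
    case True
    have "(\<Sum>i<n. norm (x i)) \<le> (\<Sum>i<n. max 1 C * rad {..<n} x)"
    proof (rule sum_mono)
      fix i assume "i \<in> {..<n}"
      then have "norm (x i) \<le> C * rad {..<n} x" using C[of n x] True by auto
      also have "\<dots> \<le> max 1 C * rad {..<n} x" by (intro mult_right_mono) auto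
      finally show "norm (x i) \<le> max 1 C * rad {..<n} x" .
    qed
    then show ?thesis by (simp add: True mult_ac)
  next
    case False
    define s where "s = real_of_ereal q"
    have s: "s \<ge> 2" using q False by (cases q) (auto simp: s_def)
    have "(\<Sum>i<n. norm (x i)) \<le> real n powr (1 - 1 / s) * (\<Sum>i<n. norm (x i) powr s) powr (1 / s)"
      using sum_le_power_mean[of "{..<n}" s "\<lambda>i. norm (x i)"] s by simp
    also have "\<dots> \<le> real n powr (1 - 1 / s) * (C * rad {..<n} x)"
      using C[of n x] False by (intro mult_left_mono) (auto simp: s_def)
    also have "\<dots> \<le> real n powr (1 - 1 / s) * (max 1 C * rad {..<n} x)"
      by (intro mult_left_mono mult_right_mono) auto
    finally show ?thesis by (simp add: s_def mult_ac)
  qed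
  then show ?thesis by (intro exI[of _ "max 1 C"]) auto
qed

text \<open>For fixed \<open>\<epsilon>\<close> the inequality \<open>L\<close> is applied to the
  block sums \<open>Y b \<epsilon>\<close>, which brings in one more sign \<open>\<eta> b\<close>
  per block. These signs are absorbed into \<open>\<epsilon>\<close> by symmetry, and what remains
  is the Rademacher average over the union of the blocks.\<close>

lemma sum_sign_avg_blocks_le:
  fixes z :: "'i \<Rightarrow> 'a::real_normed_vector" and D :: "nat \<Rightarrow> 'i set"
  assumes "finite S" "disjoint_family_on D {..<M}" "\<And>b. b < M \<Longrightarrow> D b \<subseteq> S" "L \<ge> 0"
    and L: "\<And>x :: nat \<Rightarrow> 'a. (\<Sum>b<M. norm (x b)) \<le> L * rad {..<M} x"
  shows "(\<Sum>b<M. sign_avg (D b) z norm) \<le> L * rad S z"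
proof -
  define Y where "Y b \<epsilon> = (\<Sum>i\<in>D b. \<epsilon> i *\<^sub>R z i)" for b and \<epsilon> :: "'i \<Rightarrow> real"
  define U where "U = (\<Union>b<M. D b)"
  have US: "U \<subseteq> S" using assms(3) by (auto simp: U_def)
  have finD: "finite (D b)" if "b < M" for b
    using assms(3)[OF that] assms(1) by (rule finite_subset)
  define idx where "idx i = (SOME b. b < M \<and> i \<in> D b)" for i
  have idx: "idx i = b" if "b < M" "i \<in> D b" for i b
  proof -
    have "idx i < M \<and> i \<in> D (idx i)"
      unfolding idx_def by (rule someI[of _ b]) (use that in auto)
    then show ?thesis
      using assms(2) that by (auto simp: disjoint_family_on_def)
  qed
  have "(\<Sum>b<M. sign_avg (D b) z norm) = (\<Sum>b<M. sign_mean S (\<lambda>\<epsilon>. norm (Y b \<epsilon>)))"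
    unfolding Y_def using assms(1,3) by (intro sum.cong refl sign_avg_subset) auto
  also have "\<dots> = sign_mean S (\<lambda>\<epsilon>. \<Sum>b<M. norm (Y b \<epsilon>))"
    by (simp add: sign_mean_sum)
  also have "\<dots> \<le> sign_mean S (\<lambda>\<epsilon>. L * rad {..<M} (\<lambda>b. Y b \<epsilon>))"
    by (intro sign_mean_mono L)
  also have "\<dots> = L * sign_mean S (\<lambda>\<epsilon>. rad {..<M} (\<lambda>b. Y b \<epsilon>))"
    by (rule sign_mean_cmult)
  also have "\<dots> \<le> L * sqrt (sign_mean S (\<lambda>\<epsilon>. (rad {..<M} (\<lambda>b. Y b \<epsilon>))\<^sup>2))"
    using assms(1,4) by (intro mult_left_mono sign_mean_le_sqrt)
  also have "sign_mean S (\<lambda>\<epsilon>. (rad {..<M} (\<lambda>b. Y b \<epsilon>))\<^sup>2) =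
      sign_mean S (\<lambda>\<epsilon>. sign_mean {..<M} (\<lambda>\<eta>. (norm (\<Sum>b<M. \<eta> b *\<^sub>R Y b \<epsilon>))\<^sup>2))"
    unfolding rad_square ..
  also have "\<dots> = sign_mean {..<M} (\<lambda>\<eta>. sign_mean S (\<lambda>\<epsilon>. (norm (\<Sum>b<M. \<eta> b *\<^sub>R Y b \<epsilon>))\<^sup>2))"
    by (rule sign_mean_swap)
  \<comment> \<open>For each fixed \<open>\<eta>\<close> the vectors of block \<open>b\<close> are
    multiplied by \<open>\<eta> b\<close>; \<open>idx i\<close> is the block of \<open>i\<close>,
    unique by disjointness.\<close>
  also have "\<dots> = sign_mean {..<M} (\<lambda>\<eta>. sign_avg U z (\<lambda>v. (norm v)\<^sup>2))"
  proof (rule sign_mean_cong)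
    fix \<eta> :: "nat \<Rightarrow> real" assume \<eta>: "\<eta> \<in> {..<M} \<rightarrow>\<^sub>E {-1, 1}"
    have "(\<Sum>b<M. \<eta> b *\<^sub>R Y b \<epsilon>) = (\<Sum>i\<in>U. \<epsilon> i *\<^sub>R \<eta> (idx i) *\<^sub>R z i)" for \<epsilon>
    proof -
      have "(\<Sum>b<M. \<eta> b *\<^sub>R Y b \<epsilon>) = (\<Sum>b<M. \<Sum>i\<in>D b. \<epsilon> i *\<^sub>R \<eta> (idx i) *\<^sub>R z i)"
        unfolding Y_def scaleR_sum_right
        by (intro sum.cong refl) (auto simp: idx)
      also have "\<dots> = (\<Sum>i\<in>U. \<epsilon> i *\<^sub>R \<eta> (idx i) *\<^sub>R z i)"
        unfolding U_def using finD assms(2)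
        by (subst sum.UNION_disjoint) (auto simp: disjoint_family_on_def)
      finally show ?thesis .
    qed
    then have "sign_mean S (\<lambda>\<epsilon>. (norm (\<Sum>b<M. \<eta> b *\<^sub>R Y b \<epsilon>))\<^sup>2) =
        sign_avg U (\<lambda>i. \<eta> (idx i) *\<^sub>R z i) (\<lambda>v. (norm v)\<^sup>2)"
      using US assms(1) by (simp add: sign_avg_subset)
    also have "\<dots> = sign_avg U z (\<lambda>v. (norm v)\<^sup>2)"
    proof (rule sign_avg_flip)
      show "finite U" using US assms(1) finite_subset by blast
      show "\<eta> (idx i) \<in> {-1, 1}" if "i \<in> U" for i
        using that \<eta> idx by (auto simp: U_def PiE_def Pi_def)
    qed
    finally show "sign_mean S (\<lambda>\<epsilon>. (norm (\<Sum>b<M. \<eta> b *\<^sub>R Y b \<epsilon>))\<^sup>2) =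
        sign_avg U z (\<lambda>v. (norm v)\<^sup>2)" .
  qed
  also have "L * sqrt \<dots> = L * rad U z" by (simp add: rad_def)
  also have "\<dots> \<le> L * rad S z"
    using assms(1,4) US by (intro mult_left_mono rad_mono)
  finally show ?thesis .
qed

text \<open>By scaling, the lower bound makes the \<open>k\<close>-th largest norm at most
  \<open>rad / (c * k powr \<gamma>)\<close>. The \<open>q\<close>-th powers of these bounds are
  summable because \<open>\<gamma> * q > 1\<close>.\<close>

lemma has_cotype_of_rad_lower_bound:
  assumes "c > 0" "q \<ge> 2" "\<gamma> * q > 1"
    and lower: "\<And>(S :: nat set) (z :: nat \<Rightarrow> 'a::real_normed_vector).
      finite S \<Longrightarrow> (\<And>i. i \<in> S \<Longrightarrow> norm (z i) \<ge> 1) \<Longrightarrow> c * real (card S) powr \<gamma> \<le> rad S z"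
  shows "has_cotype TYPE('a) (ereal q)"
proof -
  let ?f = "\<lambda>k::nat. real k powr (- (\<gamma> * q))"
  have summ: "summable ?f" using assms(3) by (simp add: summable_real_powr_iff)
  \<comment> \<open>The bound \<open>A\<close> is kept separate from \<open>rad S x\<close> so that
    it stays the same when a vector is removed.\<close>
  have key: "(\<Sum>i\<in>S. norm (x i) powr q) \<le> (A / c) powr q * (\<Sum>k=1..n. ?f k)"
    if "finite S" "card S = n" "rad S x \<le> A" for S n A and x :: "nat \<Rightarrow> 'a"
    using that
  proof (induction n arbitrary: S)
    case (Suc n)
    then have S: "S \<noteq> {}" by auto
    \<comment> \<open>After division by the smallest norm all \<open>Suc n\<close> vectors have norm
      at least 1, so \<open>lower\<close> applies to the whole set.\<close>
    define i where "i = arg_min_on (\<lambda>i. norm (x i)) S"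
    have i: "i \<in> S" "\<And>j. j \<in> S \<Longrightarrow> norm (x i) \<le> norm (x j)"
      using arg_min_if_finite[OF Suc.prems(1) S, of "\<lambda>i. norm (x i)"] unfolding i_def
      by (auto simp: not_less)
    have A: "A \<ge> 0" using Suc.prems(3) rad_nonneg[of S x] by linarith
    have "norm (x i) powr q \<le> (A / c) powr q * ?f (Suc n)"
    proof (cases "x i = 0")
      case False
      define m where "m = norm (x i)"
      have m: "m > 0" using False by (simp add: m_def)
      have "c * real (Suc n) powr \<gamma> \<le> rad S (\<lambda>j. (1 / m) *\<^sub>R x j)"
        using lower[OF Suc.prems(1), of "\<lambda>j. (1 / m) *\<^sub>R x j"] i m Suc.prems(2)
        by (simp add: m_def field_simps)
      also have "\<dots> = rad S x / m" using m by (subst rad_scaleR) simp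
      also have "\<dots> \<le> A / m" using Suc.prems(3) m by (simp add: divide_right_mono)
      finally have "m \<le> A / c * real (Suc n) powr (- \<gamma>)"
        using m assms(1) by (simp add: powr_minus field_simps)
      then have "m powr q \<le> (A / c * real (Suc n) powr (- \<gamma>)) powr q"
        using m assms(2) by (intro powr_mono2) auto
      also have "\<dots> = (A / c) powr q * (real (Suc n) powr (- \<gamma>)) powr q"
        by (rule powr_mult)
      also have "(real (Suc n) powr (- \<gamma>)) powr q = ?f (Suc n)"
        by (subst powr_powr) simp
      finally show ?thesis by (simp add: m_def)
    qed (use A assms(1) in simp)
    moreover have "(\<Sum>j\<in>S - {i}. norm (x j) powr q) \<le> (A / c) powr q * (\<Sum>k=1..n. ?f k)"
    proof (rule Suc.IH)
      show "card (S - {i}) = n" using Suc.prems i(1) by simp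
      show "rad (S - {i}) x \<le> A"
        using rad_mono[OF Suc.prems(1), of "S - {i}" x] Suc.prems(3) by auto
    qed (use Suc.prems in simp)
    moreover have "(\<Sum>j\<in>S. norm (x j) powr q) = norm (x i) powr q + (\<Sum>j\<in>S - {i}. norm (x j) powr q)"
      using Suc.prems(1) i(1) by (rule sum.remove)
    ultimately show ?case by (simp add: distrib_left)
  qed simp
  define Z where "Z = suminf ?f"
  have Z: "Z \<ge> 0" unfolding Z_def by (intro suminf_nonneg summ) simp
  have "(\<Sum>i<n. norm (x i) powr q) powr (1 / q) \<le> Z powr (1 / q) / c * rad {..<n} x"
    for n and x :: "nat \<Rightarrow> 'a"
  proof -
    let ?A = "rad {..<n} x"
    have "(\<Sum>i<n. norm (x i) powr q) \<le> (?A / c) powr q * (\<Sum>k=1..n. ?f k)"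
      by (rule key) auto
    also have "\<dots> \<le> (?A / c) powr q * Z"
      unfolding Z_def by (intro mult_left_mono sum_le_suminf summ) auto
    finally have "(\<Sum>i<n. norm (x i) powr q) powr (1 / q) \<le> ((?A / c) powr q * Z) powr (1 / q)"
      using assms(2) by (intro powr_mono2 sum_nonneg) auto
    also have "\<dots> = ?A / c * Z powr (1 / q)"
      using Z assms(1,2) by (simp add: powr_mult powr_powr)
    finally show ?thesis by (simp add: mult.commute)
  qed
  then have "\<exists>C. \<forall>n (x :: nat \<Rightarrow> 'a).
      (\<Sum>i<n. norm (x i) powr q) powr (1 / q) \<le> C * rad {..<n} x"
    by blast
  then show ?thesis
    using assms(2) by (simp add: has_cotype_def rademacher_average_eq_rad)
qed

subsection \<open>Weakly small families of large vectors\<close>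

text \<open>The value at \<open>\<infinity>\<close> is \<open>0\<close>, as it should be, because \<open>real_of_ereal \<infinity> = 0\<close> and \<open>1 / 0 = 0\<close>.\<close>

definition cotype_recip :: "ereal \<Rightarrow> real" where
  "cotype_recip q = 1 / real_of_ereal q"

section \<open>The cotype index and exponents close to it\<close>

lemma cotype_index_ge_2: "2 \<le> cotype_index TYPE('a::real_normed_vector)"
  unfolding cotype_index_def by (rule Inf_greatest) (auto simp: has_cotype_def)

lemma has_cotype_infinity: "has_cotype TYPE('a::real_normed_vector) \<infinity>"
  unfolding has_cotype_def rademacher_average_eq_rad
  by (auto intro!: exI[of _ 1] norm_le_rad)

lemma cotype_recip_antimono: "0 < p \<Longrightarrow> p \<le> q \<Longrightarrow> cotype_recip q \<le> cotype_recip p"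
  unfolding cotype_recip_def by (cases p; cases q; simp add: divide_left_mono)

lemma cotype_recip_nonneg: "0 \<le> q \<Longrightarrow> 0 \<le> cotype_recip q"
  by (cases q) (auto simp: cotype_recip_def)

text \<open>The infimum may fail to be attained, whence the loss \<open>\<eta>\<close>. At a finite
  index, reciprocals of numbers at least 2 differ by no more than the numbers do; at an infinite
  index the trivial cotype \<open>\<infinity>\<close> serves.\<close>

lemma exists_cotype_near_index:
  assumes "\<eta> > 0"
  shows "\<exists>q. has_cotype TYPE('a::real_normed_vector) q \<and>
    cotype_recip (cotype_index TYPE('a)) - \<eta> < cotype_recip q"
proof (cases "cotype_index TYPE('a)")
  case (real Q)
  have Q: "Q \<ge> 2" using cotype_index_ge_2[where 'a='a] real by simp
  have "cotype_index TYPE('a) < ereal (Q + \<eta>)" using real assms by simp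
  then obtain q where q: "has_cotype TYPE('a) q" "q < ereal (Q + \<eta>)"
    unfolding cotype_index_def Inf_less_iff by auto
  then have "2 \<le> q" by (simp add: has_cotype_def)
  with q(2) obtain s where s: "q = ereal s" "s \<ge> 2" "s < Q + \<eta>" by (cases q) auto
  have "1 / Q - 1 / s < \<eta>"
  proof (cases "s \<le> Q")
    case True
    then have "1 / Q \<le> 1 / s" using s by (simp add: frac_le)
    then show ?thesis using assms by simp
  next
    case False
    have "1 / Q - 1 / s = (s - Q) / (Q * s)" using Q s by (simp add: field_simps)
    also have "\<dots> \<le> (s - Q) / 1"
      using False Q s mult_mono[of 1 Q 1 s] by (intro divide_left_mono) auto
    finally show ?thesis using s by simp
  qed
  then show ?thesis using q(1) s(1) real by (intro exI[of _ q]) (auto simp: cotype_recip_def)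
next
  case PInf
  then show ?thesis
    using has_cotype_infinity assms by (intro exI[of _ \<infinity>]) (auto simp: cotype_recip_def)
next
  case MInf
  then show ?thesis using cotype_index_ge_2[where 'a='a] by simp
qed

text \<open>Otherwise \<open>has_cotype_of_rad_lower_bound\<close> would give cotype
  \<open>1 / \<delta>\<close>, below the index, for some \<open>\<delta> < \<gamma>\<close>. The
  bound \<open>\<gamma> < 1 / 2\<close> keeps \<open>1 / \<delta>\<close> above 2.\<close>

lemma exists_rad_small:
  assumes "cotype_recip (cotype_index TYPE('a::real_normed_vector)) < \<gamma>" "\<gamma> < 1 / 2" "c > 0"
  shows "\<exists>(S :: nat set) (z :: nat \<Rightarrow> 'a). finite S \<and> (\<forall>i\<in>S. norm (z i) \<ge> 1) \<and>
    rad S z < c * real (card S) powr \<gamma>"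
proof (rule ccontr)
  assume no: "\<not> ?thesis"
  let ?Q = "cotype_index TYPE('a)"
  have Q: "?Q \<ge> 2" by (rule cotype_index_ge_2)
  then have "0 \<le> cotype_recip ?Q" by (intro cotype_recip_nonneg) (auto intro: order_trans[rotated])
  then have \<gamma>: "\<gamma> > 0" using assms(1) by simp
  obtain \<delta> where \<delta>: "cotype_recip ?Q < \<delta>" "\<delta> < \<gamma>" using assms(1) dense by blast
  have \<delta>0: "\<delta> > 0" using \<delta> \<open>0 \<le> cotype_recip ?Q\<close> by simp
  have "has_cotype TYPE('a) (ereal (1 / \<delta>))"
  proof (rule has_cotype_of_rad_lower_bound[OF assms(3)])
    show "2 \<le> 1 / \<delta>" using \<delta>0 \<delta>(2) assms(2) by (simp add: field_simps)
    show "1 < \<gamma> * (1 / \<delta>)" using \<delta>0 \<delta>(2) by (simp add: field_simps)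
    show "c * real (card S) powr \<gamma> \<le> rad S z"
      if "finite S" "\<And>i. i \<in> S \<Longrightarrow> norm (z i) \<ge> 1" for S :: "nat set" and z :: "nat \<Rightarrow> 'a"
      using no that by (meson not_le)
  qed
  then have "?Q \<le> ereal (1 / \<delta>)" unfolding cotype_index_def by (intro Inf_lower) simp
  then have "cotype_recip (ereal (1 / \<delta>)) \<le> cotype_recip ?Q"
    using Q by (intro cotype_recip_antimono) (auto intro: less_le_trans[rotated])
  then show False using \<delta> \<delta>0 by (simp add: cotype_recip_def)
qed

text \<open>The costs of the halving levels grow geometrically, so the last level dominates.\<close>

lemma sum_powr_geometric_le:
  fixes a :: real
  assumes "1 / 2 \<le> a"
  shows "(\<Sum>j<p. (2 powr a) ^ j) \<le> 3 * (2 powr a) ^ p"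
proof -
  define \<rho> where "\<rho> = 2 powr a"
  \<comment> \<open>The induction step with constant 3 needs
    \<open>1 + 3 \<le> 3 * \<rho>\<close>.\<close>
  have "4 / 3 \<le> sqrt (2::real)" by (rule real_le_rsqrt) (simp add: power2_eq_square)
  also have "\<dots> = 2 powr (1 / 2)" by (simp add: powr_half_sqrt)
  also have "\<dots> \<le> \<rho>" unfolding \<rho>_def using assms by (intro powr_mono) auto
  finally have \<rho>: "\<rho> \<ge> 4 / 3" .
  have "(\<Sum>j<p. \<rho> ^ j) \<le> 3 * \<rho> ^ p"
  proof (induction p)
    case (Suc p)
    have "4 * \<rho> ^ p \<le> 3 * \<rho> * \<rho> ^ p" using \<rho> by (intro mult_right_mono) auto
    with Suc show ?case by simp
  qed simp
  then show ?thesis by (simp add: \<rho>_def)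
qed

text \<open>Cauchy-Schwarz, and orthonormality of the signs for the sum of the squares of
  \<open>g (z i)\<close>.\<close>

lemma weak_sum_le_sqrt_card_rad:
  fixes z :: "'i \<Rightarrow> 'a::real_normed_vector"
  assumes "finite S"
  shows "weak_sum S z \<le> sqrt (card S) * rad S z"
proof (rule weak_sum_least)
  fix g :: "'a \<Rightarrow> real" assume "g \<in> real_dual_ball"
  then have g: "linear g" "\<bar>g x\<bar> \<le> norm x" for x by (auto simp: real_dual_ball_def)
  have "(\<Sum>i\<in>S. (g (z i))\<^sup>2) = sign_avg S (\<lambda>i. g (z i)) (\<lambda>v. v\<^sup>2)"
    by (rule sign_avg_square[OF assms, symmetric])
  also have "\<dots> = sign_mean S (\<lambda>\<epsilon>. (g (\<Sum>i\<in>S. \<epsilon> i *\<^sub>R z i))\<^sup>2)"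
    by (simp add: sign_avg_def linear_sum[OF g(1)] linear_scale[OF g(1)])
  also have "\<dots> \<le> sign_mean S (\<lambda>\<epsilon>. (norm (\<Sum>i\<in>S. \<epsilon> i *\<^sub>R z i))\<^sup>2)"
    using g(2) by (intro sign_mean_mono) (simp add: abs_le_square_iff[symmetric])
  also have "\<dots> = (rad S z)\<^sup>2" by (rule rad_square[symmetric])
  finally have "sqrt (\<Sum>i\<in>S. (g (z i))\<^sup>2) \<le> rad S z"
    by (intro real_le_lsqrt) auto
  moreover have "(\<Sum>i\<in>S. \<bar>g (z i)\<bar>) \<le> sqrt (card S) * sqrt (\<Sum>i\<in>S. (g (z i))\<^sup>2)"
    using L2_set_mult_ineq[of "\<lambda>_. 1" "\<lambda>i. g (z i)" S] by (simp add: L2_set_def)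
  ultimately show "(\<Sum>i\<in>S. \<bar>g (z i)\<bar>) \<le> sqrt (card S) * rad S z"
    by (meson mult_left_mono order_trans real_sqrt_ge_zero of_nat_0_le_iff)
qed

text \<open>After \<open>p\<close> halvings the weak sums of all parts together are of order
  \<open>rad S z * 2 powr (p * (1 - \<alpha>))\<close>, and one of the \<open>2 ^ p\<close> parts
  does no worse than the average.\<close>

lemma exists_weakly_small_part:
  fixes z :: "nat \<Rightarrow> 'a::real_normed_vector"
  assumes "finite S" "card S = 2 ^ N" "0 \<le> \<alpha>" "\<alpha> \<le> 1 / 2" "K > 0"
    and K: "\<And>n (x :: nat \<Rightarrow> 'a).
      (\<Sum>i<n. norm (x i)) \<le> K * real n powr (1 - \<alpha>) * rad {..<n} x"
    and p: "p \<le> N" "real N \<le> 2 * (1 - \<alpha>) * real p"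
  shows "\<exists>D\<subseteq>S. card D = 2 ^ (N - p) \<and>
    weak_sum D z \<le> (1 + 6 * K) * rad S z * 2 powr (- real p * \<alpha>)"
proof -
  define X where "X j = K * (2 powr (1 - \<alpha>)) ^ j * rad S z" for j :: nat
  have pow: "real (2 ^ j) powr (1 - \<alpha>) = (2 powr (1 - \<alpha>)) ^ j" for j :: nat
    by (simp add: powr_powr mult.commute flip: powr_realpow)
  obtain D :: "nat \<Rightarrow> nat set" where D: "\<And>b. b < 2 ^ p \<Longrightarrow> D b \<subseteq> S"
    "\<And>b. b < 2 ^ p \<Longrightarrow> card (D b) = 2 ^ (N - p)"
    "(\<Sum>b<2 ^ p. weak_sum (D b) z) \<le> weak_sum S z + 2 * (\<Sum>j<p. X j)"
  proof -
    have "(\<Sum>b<2 ^ j. sign_avg (D b) z norm) \<le> X j"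
      if "disjoint_family_on D {..<2 ^ j}" "\<And>b. b < 2 ^ j \<Longrightarrow> D b \<subseteq> S"
      for j and D :: "nat \<Rightarrow> nat set"
      unfolding X_def
    proof (rule sum_sign_avg_blocks_le[OF assms(1) that])
      show "(\<Sum>b<2 ^ j. norm (x b)) \<le> K * (2 powr (1 - \<alpha>)) ^ j * rad {..<2 ^ j} x"
        for x :: "nat \<Rightarrow> 'a"
        using K[where n = "2 ^ j" and x = x] unfolding pow .
    qed (use assms(5) in auto)
    from exists_weak_sum_partition[OF assms(1,2) p(1), of z X, OF this] that show thesis
      by blast
  qed
  define A where "A = rad S z"
  have A: "A \<ge> 0" by (simp add: A_def)
  \<comment> \<open>The lower bound on \<open>p\<close> ensures that the initial factor
    \<open>sqrt (card S)\<close> does not exceed the cost of the halvings.\<close>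
  have "sqrt (card S) = 2 powr (real N / 2)"
    by (simp add: assms(2) powr_half_sqrt[symmetric] powr_powr flip: powr_realpow)
  also have "\<dots> \<le> 2 powr ((1 - \<alpha>) * real p)"
    using p(2) by (intro powr_mono) (simp_all add: field_simps)
  also have "\<dots> = (2 powr (1 - \<alpha>)) ^ p" by (simp add: powr_powr flip: powr_realpow)
  finally have sq: "sqrt (card S) \<le> (2 powr (1 - \<alpha>)) ^ p" .
  have "(\<Sum>b<2 ^ p. weak_sum (D b) z) \<le> weak_sum S z + 2 * (\<Sum>j<p. X j)" by (rule D(3))
  also have "\<dots> \<le> sqrt (card S) * A + 2 * (K * (\<Sum>j<p. (2 powr (1 - \<alpha>)) ^ j) * A)"
    using weak_sum_le_sqrt_card_rad[OF assms(1), of z]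
    by (simp add: X_def A_def sum_distrib_left sum_distrib_right)
  also have "\<dots> \<le> (2 powr (1 - \<alpha>)) ^ p * A + 2 * (K * (3 * (2 powr (1 - \<alpha>)) ^ p) * A)"
    using A assms(4,5)
    by (intro add_mono mult_left_mono mult_right_mono sq sum_powr_geometric_le) auto
  also have "\<dots> = (1 + 6 * K) * A * (2 powr (1 - \<alpha>)) ^ p" by (simp add: algebra_simps)
  finally have total: "(\<Sum>b<2 ^ p. weak_sum (D b) z) \<le> (1 + 6 * K) * A * (2 powr (1 - \<alpha>)) ^ p" .
  \<comment> \<open>Division by the number of parts turns \<open>2 powr (p * (1 - \<alpha>))\<close>
    into \<open>2 powr (- p * \<alpha>)\<close>.\<close>
  have "\<exists>b<2 ^ p. weak_sum (D b) z \<le> (1 + 6 * K) * A * 2 powr (- real p * \<alpha>)"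
  proof (rule ccontr)
    assume "\<not> ?thesis"
    then have "(\<Sum>b<(2::nat) ^ p. (1 + 6 * K) * A * 2 powr (- real p * \<alpha>)) < (\<Sum>b<2 ^ p. weak_sum (D b) z)"
      by (intro sum_strict_mono) (auto simp: not_le lessThan_empty_iff)
    also have "(\<Sum>b<(2::nat) ^ p. (1 + 6 * K) * A * 2 powr (- real p * \<alpha>))
        = (1 + 6 * K) * A * (2 powr real p * 2 powr (- real p * \<alpha>))"
      by (simp add: powr_realpow)
    also have "2 powr real p * 2 powr (- real p * \<alpha>) = (2 powr (1 - \<alpha>)) ^ p"
      by (simp add: powr_powr algebra_simps flip: powr_realpow powr_add)
    finally show False using total by simp
  qed
  then show ?thesis using D by (auto simp: A_def)
qed

text \<open>Start from \<open>2 ^ N\<close> vectors whose Rademacher average is at most of order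
  \<open>2 powr (N * \<gamma>)\<close>. Then \<open>p\<close> halvings leave a part with weak sum of
  order \<open>2 powr (N * \<gamma> - p * \<alpha>)\<close>, where \<open>\<gamma>\<close> is
  slightly above \<open>\<beta>\<close> and \<open>\<alpha>\<close> at most slightly below it. The
  target \<open>2 powr ((N - p) * \<sigma>)\<close> amounts to
  \<open>p * (\<sigma> - \<alpha>) \<le> N * (\<sigma> - \<gamma>)\<close>, which holds up to
  rounding since \<open>p\<close> is at most about \<open>\<theta> * N\<close> with
  \<open>\<theta> < 1\<close>.\<close>

lemma exists_weakly_small_family:
  assumes \<beta>: "cotype_recip (cotype_index TYPE('a::real_normed_vector)) < \<sigma>"
    and \<sigma>: "\<sigma> \<le> 1 / 2" and c: "c > 0"
  shows "\<exists>t (z :: nat \<Rightarrow> 'a). (\<forall>i<2 ^ t. norm (z i) \<ge> 1) \<and>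
    (\<forall>g\<in>real_dual_ball. (\<Sum>i<2 ^ t. \<bar>g (z i)\<bar>) \<le> c * (2 ^ t) powr \<sigma>)"
proof -
  define \<beta> where "\<beta> = cotype_recip (cotype_index TYPE('a))"
  have Q2: "2 \<le> cotype_index TYPE('a)" by (rule cotype_index_ge_2)
  have \<beta>0: "0 \<le> \<beta>" unfolding \<beta>_def
    using Q2 by (intro cotype_recip_nonneg) (auto intro: order_trans[rotated])
  have \<beta>\<sigma>: "\<beta> < \<sigma>" using \<beta> by (simp add: \<beta>_def)
  \<comment> \<open>The proportion of halvings if \<open>\<alpha>\<close> were equal to
    \<open>\<beta>\<close>. It is below 1 because \<open>\<beta> < 1 / 2\<close>.\<close>
  define \<theta> where "\<theta> = 1 / (2 * (1 - \<beta>))"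
  have \<theta>: "0 < \<theta>" "\<theta> < 1" using \<beta>\<sigma> \<sigma> by (auto simp: \<theta>_def field_simps)
  \<comment> \<open>The gap between \<open>\<theta> * (\<sigma> - \<beta>)\<close> and
    \<open>\<sigma> - \<beta>\<close> is \<open>4 * \<eta>\<close>, which leaves room for an error
    \<open>\<eta>\<close> in each of \<open>\<alpha>\<close> and \<open>\<gamma>\<close>.\<close>
  define \<eta> where "\<eta> = (1 - \<theta>) * (\<sigma> - \<beta>) / 4"
  have \<eta>: "\<eta> > 0" using \<theta> \<beta>\<sigma> by (simp add: \<eta>_def)
  obtain q where q: "has_cotype TYPE('a) q" "\<beta> - \<eta> < cotype_recip q"
    using exists_cotype_near_index[OF \<eta>, where 'a='a] by (auto simp: \<beta>_def)
  define \<alpha> where "\<alpha> = cotype_recip q"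
  obtain K where K: "K > 0" "\<And>n (x :: nat \<Rightarrow> 'a).
      (\<Sum>i<n. norm (x i)) \<le> K * real n powr (1 - \<alpha>) * rad {..<n} x"
    using has_cotype_sum_norm_le[OF q(1)] by (auto simp: \<alpha>_def cotype_recip_def)
  have \<alpha>\<beta>: "\<alpha> \<le> \<beta>"
    unfolding \<alpha>_def \<beta>_def
  proof (rule cotype_recip_antimono)
    show "0 < cotype_index TYPE('a)" using Q2 by (auto intro: less_le_trans[rotated])
    show "cotype_index TYPE('a) \<le> q" unfolding cotype_index_def using q(1) by (intro Inf_lower) simp
  qed
  have \<alpha>0: "0 \<le> \<alpha>" unfolding \<alpha>_def
    using q(1) by (intro cotype_recip_nonneg) (auto simp: has_cotype_def intro: order_trans[rotated])
  define \<gamma> where "\<gamma> = \<beta> + \<eta>"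
  have "\<eta> * 4 \<le> \<sigma> - \<beta>"
    using \<theta> \<beta>\<sigma> mult_right_mono[of "1 - \<theta>" 1 "\<sigma> - \<beta>"] by (simp add: \<eta>_def)
  then have \<gamma>: "\<beta> < \<gamma>" "\<gamma> < 1 / 2" using \<eta> \<beta>\<sigma> \<sigma> by (auto simp: \<gamma>_def)
  have slack: "\<theta> * (\<sigma> - \<alpha>) \<le> \<sigma> - \<gamma>"
  proof -
    have "\<theta> * (\<sigma> - \<alpha>) \<le> \<theta> * (\<sigma> - \<beta> + \<eta>)"
      using q(2) \<theta> by (intro mult_left_mono) (auto simp: \<alpha>_def)
    also have "\<dots> \<le> \<theta> * (\<sigma> - \<beta>) + \<eta>"
      using \<theta> \<eta> mult_right_mono[of \<theta> 1 \<eta>] by (simp add: algebra_simps)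
    also have "\<dots> = \<sigma> - \<beta> - 3 * \<eta>" by (simp add: \<eta>_def field_simps)
    also have "\<dots> \<le> \<sigma> - \<gamma>" using \<eta> by (simp add: \<gamma>_def)
    finally show ?thesis .
  qed
  \<comment> \<open>The factor \<open>1 + 6 * K\<close> comes from
    \<open>exists_weakly_small_part\<close>; the 4 pays twice a factor 2, for rounding
    \<open>card U\<close> to a power of two and for rounding \<open>p\<close> up.\<close>
  define c' where "c' = c / (4 * (1 + 6 * K))"
  have c': "c' > 0" using c K(1) by (simp add: c'_def)
  obtain U and z :: "nat \<Rightarrow> 'a" where U: "finite U" "\<And>i. i \<in> U \<Longrightarrow> norm (z i) \<ge> 1"
      "rad U z < c' * real (card U) powr \<gamma>"
    using exists_rad_small[OF \<gamma>(1)[unfolded \<beta>_def] \<gamma>(2) c'] by auto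
  have "card U \<noteq> 0" using U(3) rad_nonneg[of U z] by (cases "card U = 0") (auto simp del: rad_nonneg)
  then obtain N where N: "2 ^ N \<le> card U" "card U < 2 ^ (N + 1)"
    using ex_power_ivl1[of 2 "card U"] by auto
  obtain S where S: "S \<subseteq> U" "card S = 2 ^ N" "finite S"
    using obtain_subset_with_card_n[OF N(1)] U(1) finite_subset by metis
  have radS: "rad S z \<le> 2 * c' * 2 powr (real N * \<gamma>)"
  proof -
    have "rad S z \<le> c' * real (card U) powr \<gamma>"
      using rad_mono[OF U(1) S(1), of z] U(3) by simp
    also have "real (card U) powr \<gamma> \<le> (2 powr (real N + 1)) powr \<gamma>"
    proof (rule powr_mono2)
      have "real (card U) \<le> real (2 ^ (N + 1))" using N(2) by (intro of_nat_mono) simp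
      also have "\<dots> = 2 powr (real N + 1)" by (simp add: powr_add powr_realpow)
      finally show "real (card U) \<le> 2 powr (real N + 1)" .
    qed (use \<gamma> \<beta>0 in auto)
    also have "(2 powr (real N + 1)) powr \<gamma> = 2 powr (real N * \<gamma>) * 2 powr \<gamma>"
      by (simp add: powr_powr algebra_simps flip: powr_add)
    also have "\<dots> \<le> 2 powr (real N * \<gamma>) * 2 powr 1"
      using \<gamma> by (intro mult_left_mono powr_mono) auto
    finally show ?thesis using c' by (simp add: mult_ac)
  qed
  have \<alpha>2: "\<alpha> \<le> 1 / 2" using \<alpha>\<beta> \<beta>\<sigma> \<sigma> by simp
  \<comment> \<open>The least \<open>p\<close> with
    \<open>real N \<le> 2 * (1 - \<alpha>) * real p\<close>.\<close>
  define p where "p = nat \<lceil>real N / (2 * (1 - \<alpha>))\<rceil>"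
  have p_ge: "real N / (2 * (1 - \<alpha>)) \<le> real p"
    unfolding p_def using \<alpha>2 by (simp add: of_nat_ceiling)
  have p_less: "real p \<le> real N / (2 * (1 - \<alpha>)) + 1"
    using ceiling_correct[of "real N / (2 * (1 - \<alpha>))"] \<alpha>2 by (simp add: p_def)
  have "real N / (2 * (1 - \<alpha>)) \<le> real N / 1" using \<alpha>2 by (intro divide_left_mono) auto
  then have "p \<le> N" unfolding p_def by (simp add: ceiling_le_iff nat_le_iff)
  then obtain D where D: "D \<subseteq> S" "card D = 2 ^ (N - p)"
      "weak_sum D z \<le> (1 + 6 * K) * rad S z * 2 powr (- real p * \<alpha>)"
    using exists_weakly_small_part[OF S(3,2) \<alpha>0 \<alpha>2 K, where p = p and z = z] p_ge \<alpha>2 by (auto simp: field_simps)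
  have small: "weak_sum D z \<le> c * (2 ^ (N - p)) powr \<sigma>"
  proof -
    have "weak_sum D z \<le> (1 + 6 * K) * (2 * c' * 2 powr (real N * \<gamma>)) * 2 powr (- real p * \<alpha>)"
      using D(3) K(1) radS
      by (elim order_trans) (intro mult_left_mono mult_right_mono, auto)
    also have "\<dots> = ((1 + 6 * K) * (2 * c')) * (2 powr (real N * \<gamma>) * 2 powr (- real p * \<alpha>))"
      by (simp add: mult_ac)
    also have "(1 + 6 * K) * (2 * c') = c / 2"
      using K(1) by (simp add: c'_def field_simps)
    also have "2 powr (real N * \<gamma>) * 2 powr (- real p * \<alpha>) = 2 powr (real N * \<gamma> - real p * \<alpha>)"
      by (simp flip: powr_add)
    \<comment> \<open>The summand 1 in the exponent pays for rounding \<open>p\<close> up, because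
      \<open>\<sigma> - \<alpha> \<le> 1\<close>.\<close>
    also have "c / 2 * 2 powr (real N * \<gamma> - real p * \<alpha>) \<le> c / 2 * 2 powr ((real N - real p) * \<sigma> + 1)"
    proof (intro mult_left_mono powr_mono)
      have "real N / (2 * (1 - \<alpha>)) \<le> real N * \<theta>"
        using \<alpha>\<beta> \<beta>\<sigma> \<sigma> by (auto simp: \<theta>_def intro!: divide_left_mono)
      then have "real p * (\<sigma> - \<alpha>) \<le> (real N * \<theta> + 1) * (\<sigma> - \<alpha>)"
        using p_less \<alpha>\<beta> \<beta>\<sigma> by (intro mult_right_mono) auto
      also have "\<dots> = real N * (\<theta> * (\<sigma> - \<alpha>)) + (\<sigma> - \<alpha>)" by (simp add: algebra_simps)
      also have "\<dots> \<le> real N * (\<sigma> - \<gamma>) + 1"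
        using \<sigma> \<alpha>0 by (intro add_mono mult_left_mono slack) auto
      finally show "real N * \<gamma> - real p * \<alpha> \<le> (real N - real p) * \<sigma> + 1"
        by (simp add: algebra_simps)
    qed (use c in auto)
    also have "\<dots> = c * 2 powr (real (N - p) * \<sigma>)"
      using \<open>p \<le> N\<close> by (simp add: powr_add of_nat_diff)
    also have "2 powr (real (N - p) * \<sigma>) = (2 ^ (N - p)) powr \<sigma>"
      by (simp add: powr_powr flip: powr_realpow)
    finally show ?thesis .
  qed
  have "finite D" using D(1) S(3) finite_subset by blast
  then obtain h :: "nat \<Rightarrow> nat" where h: "bij_betw h {..<2 ^ (N - p)} D"
    using ex_bij_betw_nat_finite[of D] D(2) by (auto simp: atLeast0LessThan)
  have "norm (z (h i)) \<ge> 1" if "i < 2 ^ (N - p)" for i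
    using U(2) S(1) D(1) bij_betwE[OF h] that by blast
  moreover have "(\<Sum>i<2 ^ (N - p). \<bar>g (z (h i))\<bar>) \<le> c * (2 ^ (N - p)) powr \<sigma>"
    if "g \<in> real_dual_ball" for g
    using weak_sum_upper[OF that, of z D] small sum.reindex_bij_betw[OF h, of "\<lambda>i. \<bar>g (z i)\<bar>"]
    by simp
  ultimately show ?thesis
    by (intro exI[of _ "N - p"] exI[of _ "\<lambda>i. z (h i)"]) auto
qed

subsection \<open>Norming functionals\<close>

definition sublinear :: "('a::real_vector \<Rightarrow> real) \<Rightarrow> bool" where
  "sublinear p \<longleftrightarrow> (\<forall>x y. p (x + y) \<le> p x + p y) \<and> (\<forall>c>0. \<forall>x. p (c *\<^sub>R x) \<le> c * p x)"

lemma sublinear_scaleR: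
  assumes "sublinear p" "c > 0" shows "p (c *\<^sub>R x) = c * p x"
proof (rule antisym)
  show "p (c *\<^sub>R x) \<le> c * p x" using assms by (auto simp: sublinear_def)
  have "p ((1 / c) *\<^sub>R (c *\<^sub>R x)) \<le> (1 / c) * p (c *\<^sub>R x)"
    using assms(1) divide_pos_pos[OF zero_less_one assms(2)] unfolding sublinear_def by blast
  then show "c * p x \<le> p (c *\<^sub>R x)" using assms(2) by (simp add: field_simps)
qed

lemma sublinear_zero: "sublinear p \<Longrightarrow> p 0 = 0"
  using sublinear_scaleR[of p 2 0] by simp

lemma sublinear_add: "sublinear p \<Longrightarrow> p (x + y) \<le> p x + p y"
  by (simp add: sublinear_def)

lemma sublinear_ge_neg: "sublinear p \<Longrightarrow> - p (- x) \<le> p x"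
  using sublinear_add[of p x "- x"] sublinear_zero[of p] by simp

text \<open>A minimal sublinear functional \<open>m\<close> agrees with all of its shifts, which forces it to be additive.\<close>

definition sublinear_shift :: "('a::real_vector \<Rightarrow> real) \<Rightarrow> 'a \<Rightarrow> 'a \<Rightarrow> real" where
  "sublinear_shift m y x = (INF t\<in>{0..}. m (x + t *\<^sub>R y) - t * m y)"

text \<open>Subadditivity bounds every term of the infimum from below by \<open>- m (- x)\<close>,
  so the infimum is a genuine one.\<close>

lemma sublinear_shift_le:
  assumes "sublinear m" "t \<ge> 0"
  shows "sublinear_shift m y x \<le> m (x + t *\<^sub>R y) - t * m y"
  unfolding sublinear_shift_def
proof (rule cINF_lower)
  have "- m (- x) \<le> m (x + s *\<^sub>R y) - s * m y" if "s \<ge> 0" for s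
  proof (cases "s = 0")
    case False
    then have "s * m y = m (s *\<^sub>R y)" using that assms(1) by (simp add: sublinear_scaleR)
    also have "\<dots> \<le> m (x + s *\<^sub>R y) + m (- x)"
      using sublinear_add[OF assms(1), of "x + s *\<^sub>R y" "- x"] by simp
    finally show ?thesis by simp
  qed (use sublinear_ge_neg[OF assms(1), of x] in simp)
  then show "bdd_below ((\<lambda>t. m (x + t *\<^sub>R y) - t * m y) ` {0..})"
    by (intro bdd_belowI2[where m = "- m (- x)"]) auto
qed (use assms in simp)

lemma sublinear_shift_greatest:
  "(\<And>t. t \<ge> 0 \<Longrightarrow> b \<le> m (x + t *\<^sub>R y) - t * m y) \<Longrightarrow> b \<le> sublinear_shift m y x"
  unfolding sublinear_shift_def by (rule cINF_greatest) auto

text \<open>Parameters \<open>t\<close> for \<open>x\<close> and \<open>s\<close> for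
  \<open>x'\<close> combine to \<open>t + s\<close> for \<open>x + x'\<close>; scaling
  \<open>x\<close> by \<open>c\<close> scales \<open>t\<close> by \<open>c\<close>.\<close>

lemma sublinear_sublinear_shift:
  assumes m: "sublinear m" shows "sublinear (sublinear_shift m y)"
  unfolding sublinear_def
proof (intro conjI allI impI)
  fix x x'
  have "sublinear_shift m y (x + x') - (m (x' + s *\<^sub>R y) - s * m y) \<le> sublinear_shift m y x"
    if s: "s \<ge> 0" for s
  proof (rule sublinear_shift_greatest)
    fix t :: real assume t: "t \<ge> 0"
    have "sublinear_shift m y (x + x') \<le> m ((x + x') + (t + s) *\<^sub>R y) - (t + s) * m y"
      using s t by (intro sublinear_shift_le m) simp
    also have "m ((x + x') + (t + s) *\<^sub>R y) \<le> m (x + t *\<^sub>R y) + m (x' + s *\<^sub>R y)"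
      using sublinear_add[OF m, of "x + t *\<^sub>R y" "x' + s *\<^sub>R y"] by (simp add: algebra_simps)
    finally show "sublinear_shift m y (x + x') - (m (x' + s *\<^sub>R y) - s * m y)
        \<le> m (x + t *\<^sub>R y) - t * m y" by (simp add: algebra_simps)
  qed
  then have "sublinear_shift m y (x + x') - sublinear_shift m y x \<le> sublinear_shift m y x'"
    by (intro sublinear_shift_greatest) (simp add: algebra_simps)
  then show "sublinear_shift m y (x + x') \<le> sublinear_shift m y x + sublinear_shift m y x'"
    by simp
next
  fix c :: real and x assume c: "c > 0"
  have "sublinear_shift m y (c *\<^sub>R x) / c \<le> sublinear_shift m y x"
  proof (rule sublinear_shift_greatest)
    fix t :: real assume t: "t \<ge> 0"
    have "sublinear_shift m y (c *\<^sub>R x) \<le> m (c *\<^sub>R x + (c * t) *\<^sub>R y) - (c * t) * m y"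
      using c t by (intro sublinear_shift_le m) simp
    also have "m (c *\<^sub>R x + (c * t) *\<^sub>R y) = c * m (x + t *\<^sub>R y)"
      by (simp flip: sublinear_scaleR[OF m c] add: scaleR_add_right)
    finally show "sublinear_shift m y (c *\<^sub>R x) / c \<le> m (x + t *\<^sub>R y) - t * m y"
      using c by (simp add: field_simps)
  qed
  then show "sublinear_shift m y (c *\<^sub>R x) \<le> c * sublinear_shift m y x"
    using c by (simp add: field_simps)
qed

text \<open>Zorn's lemma for the reversed pointwise order gives a minimal sublinear functional below
  \<open>p\<close>. Minimality makes it equal to its shifts, hence linear.\<close>

lemma exists_linear_le_sublinear:
  fixes p :: "'a::real_vector \<Rightarrow> real"
  assumes p: "sublinear p"
  shows "\<exists>g. linear g \<and> (\<forall>x. g x \<le> p x)"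
proof -
  define A where "A = {q. sublinear q \<and> q \<le> p}"
  let ?P = "\<lambda>q r :: 'a \<Rightarrow> real. r \<le> q"
  have "\<exists>m\<in>A. \<forall>q\<in>A. ?P m q \<longrightarrow> q = m"
  proof (rule predicate_Zorn)
    show "partial_order_on A (relation_of ?P A)"
      by (rule partial_order_on_relation_ofI) auto
    fix C assume "C \<in> Chains (relation_of ?P A)"
    then have CA: "C \<subseteq> A" and chain: "\<And>q r. q \<in> C \<Longrightarrow> r \<in> C \<Longrightarrow> q \<le> r \<or> r \<le> q"
      by (auto simp: Chains_def relation_of_def)
    show "\<exists>u\<in>A. \<forall>q\<in>C. ?P q u"
    proof (cases "C = {}")
      case True
      then show ?thesis using p by (auto simp: A_def)
    next
      case False
      have subl: "sublinear q" and qp: "q x \<le> p x" if "q \<in> C" for q x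
        using CA that by (auto simp: A_def le_fun_def)
      define u where "u x = (INF q\<in>C. q x)" for x
      have u_le: "u x \<le> q x" if "q \<in> C" for q x
        unfolding u_def
      proof (rule cINF_lower[OF _ that], rule bdd_belowI2[where m = "- p (- x)"])
        fix r assume "r \<in> C"
        then show "- p (- x) \<le> r x" using sublinear_ge_neg[OF subl, of r x] qp[of r "- x"] by simp
      qed
      have u_ge: "b \<le> u x" if "\<And>q. q \<in> C \<Longrightarrow> b \<le> q x" for b x
        unfolding u_def by (rule cINF_greatest[OF False that])
      have "sublinear u"
        unfolding sublinear_def
      proof (intro conjI allI impI)
        fix x y
        have le: "u (x + y) \<le> q x + r y" if qr: "q \<in> C" "r \<in> C" for q r
        proof -
          \<comment> \<open>Along a chain, two members may be replaced by the smaller one; this is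
            why the infimum stays subadditive.\<close>
          obtain s where s: "s \<in> C" "s \<le> q" "s \<le> r" using chain[OF qr] qr by auto
          have "u (x + y) \<le> s (x + y)" by (rule u_le[OF s(1)])
          also have "\<dots> \<le> s x + s y" by (rule sublinear_add[OF subl[OF s(1)]])
          also have "\<dots> \<le> q x + r y" using s by (intro add_mono) (auto simp: le_fun_def)
          finally show ?thesis .
        qed
        have "u (x + y) - r y \<le> u x" if "r \<in> C" for r
          using le[OF _ that] by (intro u_ge) (simp add: algebra_simps)
        then have "u (x + y) - u x \<le> u y"
          by (intro u_ge) (simp add: algebra_simps)
        then show "u (x + y) \<le> u x + u y" by simp
      next
        fix c :: real and x assume c: "c > 0"
        have "u (c *\<^sub>R x) / c \<le> u x"
        proof (rule u_ge)
          fix q assume "q \<in> C"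
          then have "u (c *\<^sub>R x) \<le> c * q x"
            using u_le[of q "c *\<^sub>R x"] sublinear_scaleR[OF subl c] by simp
          then show "u (c *\<^sub>R x) / c \<le> q x" using c by (simp add: field_simps)
        qed
        then show "u (c *\<^sub>R x) \<le> c * u x" using c by (simp add: field_simps)
      qed
      moreover have "u \<le> p"
      proof -
        obtain q where "q \<in> C" using False by auto
        then show ?thesis unfolding le_fun_def using order_trans[OF u_le[of q] qp[of q]] by blast
      qed
      ultimately show ?thesis using u_le by (intro bexI[of _ u]) (auto simp: A_def le_fun_def)
    qed
  qed
  then obtain m where m: "sublinear m" "m \<le> p" "\<And>q. sublinear q \<Longrightarrow> q \<le> m \<Longrightarrow> q = m"
    unfolding A_def by (auto dest: order_trans)
  \<comment> \<open>The parameter 0 puts the shift below \<open>m\<close>, so minimality applies.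
    The parameter 1 then yields the missing half of additivity.\<close>
  have shift: "sublinear_shift m y = m" for y
  proof (rule m(3)[OF sublinear_sublinear_shift[OF m(1)]])
    show "sublinear_shift m y \<le> m"
      using sublinear_shift_le[OF m(1), of 0 y] by (auto simp: le_fun_def)
  qed
  have add: "m (x + y) = m x + m y" for x y
  proof (rule antisym)
    show "m x + m y \<le> m (x + y)"
      using sublinear_shift_le[OF m(1), of 1 y x] by (simp add: shift)
  qed (rule sublinear_add[OF m(1)])
  have neg: "m (- x) = - m x" for x
    using add[of x "- x"] sublinear_zero[OF m(1)] by simp
  have "m (c *\<^sub>R x) = c * m x" for c x
  proof -
    consider "c > 0" | "c = 0" | "c < 0" by linarith
    then show ?thesis
    proof cases
      case 3
      then have "m ((- c) *\<^sub>R x) = (- c) * m x" by (intro sublinear_scaleR m(1)) simp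
      then show ?thesis using neg[of "c *\<^sub>R x"] by simp
    qed (use sublinear_scaleR[OF m(1)] sublinear_zero[OF m(1)] in auto)
  qed
  then have "linear m" using add by (intro linearI) auto
  then show ?thesis using m(2) by (auto simp: le_fun_def)
qed

text \<open>Domination by the shift of the norm in direction \<open>z\<close>, not just by the norm:
  at \<open>- z\<close> with parameter 1 it forces \<open>g (- z) \<le> - norm z\<close>.\<close>

lemma exists_norming_functional:
  fixes z :: "'a::real_normed_vector"
  shows "\<exists>g\<in>real_dual_ball. g z = norm z"
proof -
  have n: "sublinear (norm :: 'a \<Rightarrow> real)"
    by (auto simp: sublinear_def norm_triangle_ineq)
  obtain g where g: "linear g" "\<And>x. g x \<le> sublinear_shift norm z x"
    using exists_linear_le_sublinear[OF sublinear_sublinear_shift[OF n]] by blast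
  have le: "g x \<le> norm x" for x
    using g(2)[of x] sublinear_shift_le[OF n, of 0 z x] by simp
  have "g (- z) \<le> - norm z"
    using g(2)[of "- z"] sublinear_shift_le[OF n, of 1 z "- z"] by simp
  then have "g z = norm z" using le[of z] linear_neg[OF g(1), of z] by simp
  moreover have "\<bar>g x\<bar> \<le> norm x" for x
    using le[of x] le[of "- x"] linear_neg[OF g(1), of x] by simp
  ultimately show ?thesis using g(1) by (auto simp: real_dual_ball_def)
qed

subsection \<open>The dual ball over the scalar field\<close>

lemma dual_ball_iff:
  fixes sm :: "'k::real_normed_field \<Rightarrow> 'a::real_normed_vector \<Rightarrow> 'a"
  assumes sm: "normed_space_over sm"
  shows "f \<in> dual_ball sm \<longleftrightarrow>
    (\<forall>x y. f (x + y) = f x + f y) \<and> (\<forall>a x. f (sm a x) = a * f x) \<and> (\<forall>x. norm (f x) \<le> norm x)"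
    (is "_ \<longleftrightarrow> ?R")
proof -
  interpret normed_space_over sm by (rule sm)
  have vs: "vector_space ((*) :: 'k \<Rightarrow> 'k \<Rightarrow> 'k)"
    by unfold_locales (simp_all add: algebra_simps)
  have "?R" if "f \<in> dual_ball sm"
  proof -
    have f: "Vector_Spaces.linear sm (*) f" "bounded_linear f" "onorm f \<le> 1"
      using that by (auto simp: dual_ball_def)
    have "norm (f x) \<le> norm x" for x
      using onorm[OF f(2), of x] mult_right_mono[OF f(3), of "norm x"] by simp
    then show ?R using f(1) by (simp add: Vector_Spaces.linear_iff)
  qed
  moreover have "f \<in> dual_ball sm" if R: "?R"
  proof -
    have "f (c *\<^sub>R x) = c *\<^sub>R f x" for c x
      using R by (simp flip: sm_of_real add: scaleR_conv_of_real)
    then have bl: "bounded_linear f"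
      using R by (intro bounded_linear_intro[where K = 1]) auto
    moreover have "onorm f \<le> 1" using R by (intro onorm_bound) auto
    ultimately show ?thesis
      using R vs vector_space_axioms by (simp add: dual_ball_def Vector_Spaces.linear_iff)
  qed
  ultimately show ?thesis by blast
qed

section \<open>Passing between real and complex scalars\<close>

lemma normed_space_over_scaleR: "normed_space_over (scaleR :: real \<Rightarrow> 'a::real_normed_vector \<Rightarrow> 'a)"
  by unfold_locales (simp_all add: scaleR_add_right scaleR_add_left)

lemma dual_ball_scaleR: "dual_ball (scaleR :: real \<Rightarrow> 'a::real_normed_vector \<Rightarrow> 'a) = real_dual_ball"
  by (auto simp: dual_ball_iff[OF normed_space_over_scaleR] real_dual_ball_def linear_iff)

lemma Re_Im_in_real_dual_ball:
  assumes sm: "normed_space_over (sm :: complex \<Rightarrow> 'a::real_normed_vector \<Rightarrow> 'a)" and f: "f \<in> dual_ball sm"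
  shows "(\<lambda>x. Re (f x)) \<in> real_dual_ball" "(\<lambda>x. Im (f x)) \<in> real_dual_ball"
proof -
  interpret normed_space_over sm by (rule sm)
  have f': "f (x + y) = f x + f y" "f (sm a x) = a * f x" "norm (f x) \<le> norm x" for x y a
    using f by (auto simp: dual_ball_iff[OF sm])
  have "f (c *\<^sub>R x) = c *\<^sub>R f x" for c x
    using f'(2)[of "of_real c" x] by (simp add: sm_of_real scaleR_conv_of_real)
  then show "(\<lambda>x. Re (f x)) \<in> real_dual_ball" "(\<lambda>x. Im (f x)) \<in> real_dual_ball"
    using f'(1) order_trans[OF abs_Re_le_cmod f'(3)] order_trans[OF abs_Im_le_cmod f'(3)]
    by (auto simp: real_dual_ball_def linear_iff)
qed

text \<open>A real norming functional \<open>g\<close> is complexified as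
  \<open>f x = g x - \<i> * g (\<i> x)\<close>, whose real part is \<open>g\<close>.\<close>

lemma exists_complex_norming_functional:
  assumes sm: "normed_space_over (sm :: complex \<Rightarrow> 'a::real_normed_vector \<Rightarrow> 'a)"
  shows "\<exists>f\<in>dual_ball sm. norm z \<le> norm (f z)"
proof -
  interpret normed_space_over sm by (rule sm)
  obtain g where "g \<in> real_dual_ball" and gz: "g z = norm z"
    using exists_norming_functional[of z] by blast
  then have g: "linear g" "\<bar>g x\<bar> \<le> norm x" for x by (auto simp: real_dual_ball_def)
  define f where "f x = Complex (g x) (- g (sm \<i> x))" for x
  have add: "f (x + y) = f x + f y" for x y
    by (simp add: f_def complex_eq_iff linear_add[OF g(1)] scale_right_distrib)
  have g_sm: "g (sm a x) = Re a * g x + Im a * g (sm \<i> x)" for a x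
  proof -
    have "sm a x = sm (of_real (Re a) + of_real (Im a) * \<i>) x"
      by (rule arg_cong[where f = "\<lambda>a. sm a x"]) (simp add: complex_eq_iff)
    also have "\<dots> = Re a *\<^sub>R x + Im a *\<^sub>R sm \<i> x"
      by (simp only: scale_left_distrib scale_scale[symmetric] sm_of_real)
    finally show ?thesis by (simp add: linear_add[OF g(1)] linear_scale[OF g(1)])
  qed
  have scale: "f (sm a x) = a * f x" for a x
    by (simp add: f_def complex_eq_iff g_sm[of a] g_sm[of "\<i> * a"] scale_scale algebra_simps)
  have "norm (f x) \<le> norm x" for x
  proof (cases "f x = 0")
    case False
    \<comment> \<open>Multiplication by this unimodular number makes the value of \<open>f\<close>
      real and nonnegative, where it agrees with \<open>g\<close>.\<close>
    define a where "a = cnj (f x) / norm (f x)"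
    have a: "norm a = 1" "a * f x = norm (f x)"
      using False complex_norm_square[of "f x"]
      by (auto simp: a_def norm_divide divide_eq_eq power2_eq_square mult.commute)
    have "norm (f x) = Re (f (sm a x))" by (simp add: scale a(2))
    also have "\<dots> = g (sm a x)" by (simp add: f_def)
    also have "\<dots> \<le> norm (sm a x)" using g(2)[of "sm a x"] by simp
    also have "\<dots> = norm x" by (simp add: norm_sm a(1))
    finally show ?thesis .
  qed simp
  then have "f \<in> dual_ball sm" by (simp add: dual_ball_iff[OF sm] add scale)
  moreover have "norm z \<le> norm (f z)"
    using abs_Re_le_cmod[of "f z"] gz by (simp add: f_def)
  ultimately show ?thesis by blast
qed

subsection \<open>Sylvester matrices\<close>

text \<open>The Hadamard matrix of order \<open>2 ^ t\<close>, built from four blocks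
  \<open>H\<close>, \<open>H\<close>, \<open>H\<close>, \<open>- H\<close>, the negative one at the
  lower right. The remainders locate an entry inside its block.\<close>

fun sylvester :: "nat \<Rightarrow> nat \<Rightarrow> nat \<Rightarrow> real" where
  "sylvester 0 k i = 1"
| "sylvester (Suc t) k i = (if 2 ^ t \<le> k \<and> 2 ^ t \<le> i then -1 else 1) * sylvester t (k mod 2 ^ t) (i mod 2 ^ t)"

lemma abs_sylvester: "\<bar>sylvester t k i\<bar> = 1"
  by (induction t arbitrary: k i) (auto simp: abs_mult)

lemma sum_lessThan_add: "(\<Sum>i<m + n. f i) = (\<Sum>i<m. f i) + (\<Sum>i<n. f (m + i))"
  for f :: "nat \<Rightarrow> 'a::comm_monoid_add"
  by (induction n) (simp_all add: algebra_simps)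

lemma parallelogram_law:
  "(norm (u + w))\<^sup>2 + (norm (u - w))\<^sup>2 = 2 * (norm u)\<^sup>2 + 2 * (norm w)\<^sup>2" for u w :: "'a::real_inner"
  by (simp add: power2_norm_eq_inner inner_add inner_diff inner_commute)

text \<open>The matrix divided by \<open>sqrt (2 ^ t)\<close> is orthogonal. Stating this for
  vectors of an inner product space covers real and complex scalars at once.\<close>

lemma sum_norm_square_sylvester:
  fixes v :: "nat \<Rightarrow> 'a::real_inner"
  shows "(\<Sum>k<2 ^ t. (norm (\<Sum>i<2 ^ t. sylvester t k i *\<^sub>R v i))\<^sup>2) = 2 ^ t * (\<Sum>i<2 ^ t. (norm (v i))\<^sup>2)"
proof (induction t arbitrary: v)
  case (Suc t)
  define n :: nat where "n = 2 ^ t"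
  have nn: "n + n = 2 ^ Suc t" by (simp add: n_def)
  define u where "u k = (\<Sum>i<n. sylvester t k i *\<^sub>R v i)" for k
  define w where "w k = (\<Sum>i<n. sylvester t k i *\<^sub>R v (n + i))" for k
  \<comment> \<open>The upper half of the rows gives \<open>u k + w k\<close>, the lower half
    \<open>u k - w k\<close>, ready for the parallelogram law.\<close>
  have rows: "(\<Sum>i<n + n. sylvester (Suc t) k i *\<^sub>R v i) = u k + w k"
    "(\<Sum>i<n + n. sylvester (Suc t) (n + k) i *\<^sub>R v i) = u k - w k" if "k < n" for k
    using that unfolding sum_lessThan_add u_def w_def
    by (simp_all add: n_def sum_negf[symmetric] flip: scaleR_minus_left)
  have "(\<Sum>k<n + n. (norm (\<Sum>i<n + n. sylvester (Suc t) k i *\<^sub>R v i))\<^sup>2) =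
      (\<Sum>k<n. (norm (u k + w k))\<^sup>2 + (norm (u k - w k))\<^sup>2)"
    unfolding sum_lessThan_add[of _ n n, where f = "\<lambda>k. (norm (\<Sum>i<n + n. sylvester (Suc t) k i *\<^sub>R v i))\<^sup>2"]
    by (simp add: rows sum.distrib del: sylvester.simps)
  also have "\<dots> = 2 * (\<Sum>k<n. (norm (u k))\<^sup>2) + 2 * (\<Sum>k<n. (norm (w k))\<^sup>2)"
    by (simp add: parallelogram_law sum.distrib sum_distrib_left)
  also have "\<dots> = 2 ^ Suc t * (\<Sum>i<n + n. (norm (v i))\<^sup>2)"
    unfolding sum_lessThan_add using Suc.IH[of v] Suc.IH[of "\<lambda>i. v (n + i)"]
    by (simp add: n_def u_def w_def algebra_simps)
  finally show ?case unfolding nn .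
qed simp

text \<open>With \<open>n = 2 ^ t\<close>, Cauchy-Schwarz contributes \<open>sqrt n\<close> and the
  quadratic identity contributes \<open>n\<close>.\<close>

lemma sum_norm_sylvester_le:
  fixes v :: "nat \<Rightarrow> 'a::real_inner"
  assumes "\<And>i. norm (v i) \<le> 1"
  shows "(\<Sum>k<2 ^ t. norm (\<Sum>i<2 ^ t. sylvester t k i *\<^sub>R v i)) \<le> (2 ^ t) powr (3 / 2)"
proof -
  let ?n = "2 ^ t :: real"
  let ?y = "\<lambda>k. norm (\<Sum>i<2 ^ t. sylvester t k i *\<^sub>R v i)"
  have "(\<Sum>k<2 ^ t. \<bar>1\<bar> * \<bar>?y k\<bar>) \<le> L2_set (\<lambda>_. 1) {..<(2::nat) ^ t} * L2_set ?y {..<2 ^ t}"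
    by (rule L2_set_mult_ineq)
  also have "L2_set ?y {..<2 ^ t} \<le> ?n"
  proof -
    have "(\<Sum>i<2 ^ t. (norm (v i))\<^sup>2) \<le> (\<Sum>i<(2::nat) ^ t. 1)"
      using assms by (intro sum_mono) (simp add: power_le_one)
    then have "?n * (\<Sum>i<2 ^ t. (norm (v i))\<^sup>2) \<le> ?n * ?n"
      by (intro mult_left_mono) simp_all
    then have "(\<Sum>k<2 ^ t. (?y k)\<^sup>2) \<le> ?n\<^sup>2"
      unfolding sum_norm_square_sylvester power2_eq_square[of ?n] .
    from real_sqrt_le_mono[OF this] show ?thesis by (simp add: L2_set_def)
  qed
  also have "L2_set (\<lambda>_. 1) {..<(2::nat) ^ t} = sqrt ?n" by (simp add: L2_set_def)
  also have "sqrt ?n * ?n = ?n powr (1 / 2) * ?n powr 1" by (simp add: powr_half_sqrt)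
  also have "\<dots> = ?n powr (3 / 2)" by (subst powr_add[symmetric]) simp
  finally show ?thesis by (simp add: mult_left_mono)
qed

section \<open>Convexity of powers and the choice of signs\<close>

lemma powr_midconvex:
  fixes a b r :: real
  assumes "a \<ge> 0" "b \<ge> 0" "r \<ge> 1"
  shows "((a + b) / 2) powr r \<le> (a powr r + b powr r) / 2"
proof -
  have half: "(x / 2) powr r \<le> x powr r / 2" if "x \<ge> 0" for x
  proof -
    have "(2::real) powr 1 \<le> 2 powr r" using assms(3) by (intro powr_mono) auto
    then have "x powr r / 2 powr r \<le> x powr r / 2" by (intro divide_left_mono) auto
    then show ?thesis using that by (simp add: powr_divide)
  qed
  consider "a = 0" | "b = 0" | "a > 0" "b > 0" using assms by linarith
  then show ?thesis
  proof cases
    case 3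
    then show ?thesis
      using convex_onD[OF powr_convex[OF assms(3)], of "1 / 2" a b] by (simp add: field_simps)
  qed (use half assms in auto)
qed

lemma norm_powr_midconvex:
  fixes v w :: "'a::real_normed_vector"
  assumes "r \<ge> 1"
  shows "norm v powr r \<le> (norm (v + w) powr r + norm (v - w) powr r) / 2"
proof -
  have "norm v powr r \<le> ((norm (v + w) + norm (v - w)) / 2) powr r"
    using assms by (intro powr_mono2 norm_midconvex) auto
  also have "\<dots> \<le> (norm (v + w) powr r + norm (v - w) powr r) / 2"
    using assms by (intro powr_midconvex) auto
  finally show ?thesis .
qed

text \<open>By convexity, the average over the signs of a coordinate in which only one term is known
  to be large is at least that term, whatever the other terms are.\<close>

lemma exists_signs_large_sylvester_sum:
  fixes y :: "nat \<Rightarrow> nat \<Rightarrow> 'a::real_normed_vector"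
  assumes "r \<ge> 1" "\<And>l. l < 2 ^ t \<Longrightarrow> norm (y l l) \<ge> 1"
  shows "\<exists>\<delta>. (\<forall>i<2 ^ t. \<bar>\<delta> i\<bar> = 1) \<and>
    (2 ^ t)\<^sup>2 \<le> (\<Sum>k<2 ^ t. \<Sum>l<2 ^ t. norm (\<Sum>i<2 ^ t. sylvester t k i *\<^sub>R \<delta> i *\<^sub>R y i l) powr r)"
proof -
  let ?I = "{..<2 ^ t :: nat}"
  let ?F = "\<lambda>\<delta>. \<Sum>k\<in>?I. \<Sum>l\<in>?I. norm (\<Sum>i\<in>?I. \<delta> i *\<^sub>R sylvester t k i *\<^sub>R y i l) powr r"
  have one: "1 \<le> sign_mean ?I (\<lambda>\<delta>. norm (\<Sum>i\<in>?I. \<delta> i *\<^sub>R sylvester t k i *\<^sub>R y i l) powr r)"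
    if "l \<in> ?I" for k l
  proof -
    have "1 powr r \<le> norm (sylvester t k l *\<^sub>R y l l) powr r"
      using assms that by (intro powr_mono2) (auto simp: abs_sylvester)
    also have "\<dots> = sign_avg {l} (\<lambda>i. sylvester t k i *\<^sub>R y i l) (\<lambda>v. norm v powr r)"
      by (simp add: sign_avg_insert)
    also have "\<dots> \<le> sign_avg ?I (\<lambda>i. sylvester t k i *\<^sub>R y i l) (\<lambda>v. norm v powr r)"
      using that by (intro sign_avg_subset_le norm_powr_midconvex assms(1)) auto
    finally show ?thesis by (simp add: sign_avg_def)
  qed
  \<comment> \<open>Each of the \<open>2 ^ t * 2 ^ t\<close> terms has average at least 1, so one
    choice of signs serves the whole double sum.\<close>
  have "(2 ^ t)\<^sup>2 = (\<Sum>k\<in>?I. \<Sum>l\<in>?I. 1 :: real)" by (simp add: power2_eq_square)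
  also have "\<dots> \<le> (\<Sum>k\<in>?I. \<Sum>l\<in>?I.
      sign_mean ?I (\<lambda>\<delta>. norm (\<Sum>i\<in>?I. \<delta> i *\<^sub>R sylvester t k i *\<^sub>R y i l) powr r))"
    by (intro sum_mono one)
  also have "\<dots> = sign_mean ?I ?F" by (simp add: sign_mean_sum)
  finally obtain \<delta> where \<delta>: "\<delta> \<in> ?I \<rightarrow>\<^sub>E {-1, 1}" "(2 ^ t)\<^sup>2 \<le> ?F \<delta>"
    using sign_mean_ex_ge[of ?I ?F] by (meson finite_lessThan order_trans)
  have "\<bar>\<delta> i\<bar> = 1" if "i < 2 ^ t" for i
    using PiE_mem[OF \<delta>(1), of i] that by auto
  then show ?thesis
    using \<delta>(2) by (intro exI[of _ \<delta>] conjI) (simp_all add: mult.commute)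
qed

subsection \<open>Bilinear forms on \<open>\<ell>\<^sub>1 \<times> Z\<close>\<close>

lift_definition ell1_unit :: "nat \<Rightarrow> 'k::real_normed_field ell1" is "\<lambda>p n. if n = p then 1 else 0"
proof -
  fix p
  have "summable (\<lambda>n. if n = p then norm (1::'k) else 0)" by (rule summable_single)
  then show "summable (\<lambda>n. norm (if n = p then 1 else 0 :: 'k))"
    by (rule summable_cong[THEN iffD1, rotated]) auto
qed

lemma norm_ell1: "norm x = (\<Sum>n. norm (ell1_nth x n))"
  by transfer simp

lemma norm_ell1_unit: "norm (ell1_unit p :: 'k::real_normed_field ell1) = 1"
proof -
  have "(\<lambda>n. norm (ell1_nth (ell1_unit p :: 'k ell1) n)) = (\<lambda>n. if n = p then 1 else 0)"
    by (auto simp: ell1_unit.rep_eq)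
  then show ?thesis using sums_single[of p "\<lambda>_. 1 :: real"] by (simp add: norm_ell1 sums_iff)
qed

lemma norm_ell1_nth_le: "norm (ell1_nth x p) \<le> norm x"
  using sum_le_suminf[OF summable_norm_ell1[of x], of "{p}"] by (simp add: norm_ell1)

lemma bounded_linear_ell1_nth: "bounded_linear (\<lambda>x. ell1_nth x p)"
  by (rule bounded_linear_intro[where K = 1])
    (auto simp: plus_ell1.rep_eq scaleR_ell1.rep_eq norm_ell1_nth_le)

text \<open>Bounded bilinear forms on \<open>\<ell>\<^sub>1 \<times> Z\<close> correspond to bounded
  sequences of functionals on \<open>Z\<close>: \<open>\<Phi> p\<close> is the form at the
  \<open>p\<close>-th unit vector.\<close>

definition ell1_form :: "(nat \<Rightarrow> 'a \<Rightarrow> 'k) \<Rightarrow> 'k::real_normed_field ell1 \<Rightarrow> 'a \<Rightarrow> 'k" where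
  "ell1_form \<Phi> x y = (\<Sum>p. ell1_nth x p * \<Phi> p y)"

context
  fixes sm :: "'k::{real_normed_field, banach} \<Rightarrow> 'a::real_normed_vector \<Rightarrow> 'a" and \<Phi> :: "nat \<Rightarrow> 'a \<Rightarrow> 'k"
  assumes sm: "normed_space_over sm" and \<Phi>: "\<And>p. \<Phi> p \<in> dual_ball sm"
begin

lemma functional_simps:
  "\<Phi> p (x + y) = \<Phi> p x + \<Phi> p y" "\<Phi> p (sm a x) = a * \<Phi> p x" "norm (\<Phi> p x) \<le> norm x"
  "\<Phi> p (c *\<^sub>R x) = c *\<^sub>R \<Phi> p x"
proof -
  show l: "\<Phi> p (sm a x) = a * \<Phi> p x" for a x using \<Phi>[of p] by (simp add: dual_ball_iff[OF sm])
  show "\<Phi> p (x + y) = \<Phi> p x + \<Phi> p y" "norm (\<Phi> p x) \<le> norm x"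
    using \<Phi>[of p] by (auto simp: dual_ball_iff[OF sm])
  show "\<Phi> p (c *\<^sub>R x) = c *\<^sub>R \<Phi> p x"
    using l[of "of_real c" x] by (simp add: normed_space_over.sm_of_real[OF sm] scaleR_conv_of_real)
qed

lemma norm_ell1_form_term_le: "norm (ell1_nth x p * \<Phi> p y) \<le> norm (ell1_nth x p) * norm y"
  by (simp add: norm_mult mult_left_mono functional_simps)

lemma summable_norm_ell1_form: "summable (\<lambda>p. norm (ell1_nth x p * \<Phi> p y))"
proof (rule summable_comparison_test'[OF summable_mult2[OF summable_norm_ell1], where N = 0])
  show "norm (norm (ell1_nth x p * \<Phi> p y)) \<le> norm (ell1_nth x p) * norm y" for p
    unfolding real_norm_def abs_norm_cancel by (rule norm_ell1_form_term_le)
qed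

lemma summable_ell1_form: "summable (\<lambda>p. ell1_nth x p * \<Phi> p y)"
  by (rule summable_norm_cancel[OF summable_norm_ell1_form])

lemma ell1_form_sm_right: "ell1_form \<Phi> x (sm a y) = a * ell1_form \<Phi> x y"
  unfolding ell1_form_def suminf_mult[OF summable_ell1_form, symmetric]
  by (simp add: functional_simps mult.left_commute)

lemma ell1_form_scale_left: "ell1_form \<Phi> (ell1_scale a x) y = a * ell1_form \<Phi> x y"
  unfolding ell1_form_def suminf_mult[OF summable_ell1_form, symmetric]
  by (simp add: ell1_scale.rep_eq mult.assoc)

lemma bounded_bilinear_ell1_form: "bounded_bilinear (ell1_form \<Phi>)"
proof
  fix x x' :: "'k ell1" and y y' :: 'a and c :: real
  show "ell1_form \<Phi> (x + x') y = ell1_form \<Phi> x y + ell1_form \<Phi> x' y"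
    by (simp add: ell1_form_def plus_ell1.rep_eq distrib_right suminf_add[OF summable_ell1_form summable_ell1_form])
  show "ell1_form \<Phi> x (y + y') = ell1_form \<Phi> x y + ell1_form \<Phi> x y'"
    by (simp add: ell1_form_def functional_simps distrib_left suminf_add[OF summable_ell1_form summable_ell1_form])
  show "ell1_form \<Phi> (c *\<^sub>R x) y = c *\<^sub>R ell1_form \<Phi> x y"
    by (simp add: ell1_form_def scaleR_ell1.rep_eq suminf_scaleR_right[OF summable_ell1_form])
  show "ell1_form \<Phi> x (c *\<^sub>R y) = c *\<^sub>R ell1_form \<Phi> x y"
    by (simp add: ell1_form_def functional_simps suminf_scaleR_right[OF summable_ell1_form])
  have "norm (ell1_form \<Phi> x y) \<le> norm x * norm y * 1" for x y
  proof -
    have "norm (ell1_form \<Phi> x y) \<le> (\<Sum>p. norm (ell1_nth x p * \<Phi> p y))"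
      unfolding ell1_form_def by (rule summable_norm[OF summable_norm_ell1_form])
    also have "\<dots> \<le> (\<Sum>p. norm (ell1_nth x p) * norm y)"
      by (rule suminf_le[OF norm_ell1_form_term_le summable_norm_ell1_form summable_mult2[OF summable_norm_ell1]])
    also have "\<dots> = norm x * norm y"
      by (simp add: norm_ell1 suminf_mult2[OF summable_norm_ell1, symmetric])
    finally show ?thesis by simp
  qed
  then show "\<exists>K. \<forall>x y. norm (ell1_form \<Phi> x y) \<le> norm x * norm y * K" by blast
qed

lemma ell1_form_unit: "ell1_form \<Phi> (ell1_unit p) y = \<Phi> p y"
proof -
  have "(\<lambda>n. ell1_nth (ell1_unit p) n * \<Phi> n y) = (\<lambda>n. if n = p then \<Phi> n y else 0)"
    by (auto simp: ell1_unit.rep_eq)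
  then show ?thesis using sums_single[of p "\<lambda>n. \<Phi> n y"] by (simp add: ell1_form_def sums_iff)
qed

text \<open>In the proof, all \<open>\<ell>\<^sub>1\<close> factors except the one at \<open>j0\<close> receive a single unit vector, so they do not
  affect the sums.\<close>

definition multi_form :: "'m \<Rightarrow> ('m::finite \<Rightarrow> 'k ell1) \<Rightarrow> 'a \<Rightarrow> 'k" where
  "multi_form j0 x y = (\<Prod>j\<in>UNIV - {j0}. ell1_nth (x j) 0) * ell1_form \<Phi> (x j0) y"

lemma multi_form_continuous_multilinear:
  "multi_form j0 \<in> continuous_multilinear ell1_scale sm (*)"
proof -
  interpret sm: normed_space_over sm by (rule sm)
  interpret B: bounded_bilinear "ell1_form \<Phi>" by (rule bounded_bilinear_ell1_form)
  interpret l1: normed_space_over "ell1_scale :: 'k \<Rightarrow> 'k ell1 \<Rightarrow> 'k ell1" by (rule normed_space_over_ell1)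
  have vs: "vector_space ((*) :: 'k \<Rightarrow> 'k \<Rightarrow> 'k)"
    by unfold_locales (simp_all add: algebra_simps)
  have "Vector_Spaces.linear ell1_scale (*) (\<lambda>u. multi_form j0 (x(j := u)) z)" for x j z
  proof (cases "j = j0")
    case True
    have "(\<Prod>i\<in>UNIV - {j0}. ell1_nth ((x(j0 := u)) i) 0) = (\<Prod>i\<in>UNIV - {j0}. ell1_nth (x i) 0)" for u
      by (intro prod.cong) auto
    then show ?thesis
      by (simp add: Vector_Spaces.linear_iff vs l1.vector_space_axioms multi_form_def True B.add_left
          ell1_form_scale_left algebra_simps)
  next
    case False
    have "(\<Prod>i\<in>UNIV - {j0}. ell1_nth ((x(j := u)) i) 0) =
        ell1_nth u 0 * (\<Prod>i\<in>UNIV - {j0} - {j}. ell1_nth (x i) 0)" for u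
    proof -
      have "(\<Prod>i\<in>UNIV - {j0}. ell1_nth ((x(j := u)) i) 0) =
          ell1_nth ((x(j := u)) j) 0 * (\<Prod>i\<in>UNIV - {j0} - {j}. ell1_nth ((x(j := u)) i) 0)"
        using False by (intro prod.remove) auto
      also have "(\<Prod>i\<in>UNIV - {j0} - {j}. ell1_nth ((x(j := u)) i) 0) =
          (\<Prod>i\<in>UNIV - {j0} - {j}. ell1_nth (x i) 0)"
        by (intro prod.cong) auto
      finally show ?thesis by simp
    qed
    then show ?thesis using False
      by (simp add: Vector_Spaces.linear_iff vs l1.vector_space_axioms multi_form_def
          plus_ell1.rep_eq ell1_scale.rep_eq algebra_simps)
  qed
  moreover have "Vector_Spaces.linear sm (*) (multi_form j0 x)" for x
    by (simp add: Vector_Spaces.linear_iff vs sm.vector_space_axioms multi_form_def B.add_right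
        ell1_form_sm_right algebra_simps)
  moreover have "continuous_on UNIV (\<lambda>(x, z). multi_form j0 x z)"
  proof -
    have coord: "continuous_on UNIV (\<lambda>q :: ('m \<Rightarrow> 'k ell1) \<times> 'a. fst q j)" for j
      by (rule continuous_on_product_then_coordinatewise[OF continuous_on_fst[OF continuous_on_id]])
    show ?thesis
      unfolding case_prod_beta multi_form_def
      by (intro continuous_on_mult continuous_on_prod B.continuous_on coord
          bounded_linear.continuous_on[OF bounded_linear_ell1_nth] continuous_on_snd continuous_on_id)
  qed
  ultimately show ?thesis by (simp add: continuous_multilinear_def)
qed

end

subsection \<open>The lower bound\<close>

text \<open>Only finitely many terms are nonzero and \<open>ennreal_root 1\<close> is the identity
  on finite values, so finite real sums decide.\<close>

lemma weak_norm_one_le: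
  assumes sm: "normed_space_over (sm :: 'k::real_normed_field \<Rightarrow> 'a::real_normed_vector \<Rightarrow> 'a)"
    and le: "\<And>f. f \<in> dual_ball sm \<Longrightarrow> (\<Sum>i<n. norm (f (x i))) \<le> b"
    and zero: "\<And>i. i \<ge> n \<Longrightarrow> x i = 0"
  shows "weak_norm 1 sm x \<le> ennreal b"
  unfolding weak_norm_def
proof (rule SUP_least)
  fix f assume f: "f \<in> dual_ball sm"
  then have f0: "norm (f 0) = 0" by (auto simp: dual_ball_iff[OF sm] dest: spec[of _ 0])
  have "(\<Sum>\<^sub>\<infinity>i\<in>UNIV. ennreal (norm (f (x i)) powr 1)) = (\<Sum>\<^sub>\<infinity>i\<in>{..<n}. ennreal (norm (f (x i))))"
    using zero f0 by (intro infsum_cong_neutral) auto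
  also have "\<dots> = ennreal (\<Sum>i<n. norm (f (x i)))"
    by (simp add: sum_ennreal)
  finally have "ennreal_root 1 (\<Sum>\<^sub>\<infinity>i\<in>UNIV. ennreal (norm (f (x i)) powr 1)) = ennreal (\<Sum>i<n. norm (f (x i)))"
    by (simp add: ennreal_root_def sum_nonneg)
  also have "\<dots> \<le> ennreal b" by (intro ennreal_leI le f)
  finally show "ennreal_root 1 (\<Sum>\<^sub>\<infinity>i\<in>UNIV. ennreal (norm (f (x i)) powr 1)) \<le> ennreal b" .
qed

lemma ennreal_root_ge:
  assumes "ennreal v \<le> s" "v \<ge> 0" "r > 0"
  shows "ennreal (v powr (1 / r)) \<le> ennreal_root r s"
proof (cases s)
  case (real u)
  then have "v \<le> u" using assms by simp
  then show ?thesis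
    using real assms by (simp add: ennreal_root_def powr_mono2)
qed (simp add: ennreal_root_def)

lemma prod_ennreal_le:
  fixes w :: "'m::finite \<Rightarrow> ennreal"
  assumes "w j0 \<le> b" "\<And>j. j \<noteq> j0 \<Longrightarrow> w j \<le> 1"
  shows "(\<Prod>j\<in>UNIV. w j) \<le> b"
proof -
  have le1: "(\<Prod>j\<in>A. w j) \<le> 1" if "finite A" "j0 \<notin> A" for A
    using that
  proof (induction A rule: finite_induct)
    case (insert a A)
    then have "w a * (\<Prod>j\<in>A. w j) \<le> 1 * 1" using assms(2) by (intro mult_mono) auto
    then show ?case using insert by simp
  qed simp
  have "(\<Prod>j\<in>UNIV. w j) = w j0 * (\<Prod>j\<in>UNIV - {j0}. w j)" by (intro prod.remove) auto
  also have "\<dots> \<le> b * 1" by (intro mult_mono assms(1) le1) auto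
  finally show ?thesis by simp
qed

lemma scaleR_in_dual_ball:
  assumes sm: "normed_space_over sm" and "f \<in> dual_ball sm" "\<bar>c\<bar> \<le> 1"
  shows "(\<lambda>x. c *\<^sub>R f x) \<in> dual_ball sm"
proof -
  have "norm (c *\<^sub>R f x) \<le> norm x" for x
    using mult_mono[OF assms(3), of "norm (f x)" "norm x"] assms(2) by (simp add: dual_ball_iff[OF sm])
  then show ?thesis
    using assms(2) by (simp add: dual_ball_iff[OF sm] scaleR_add_right)
qed

text \<open>For every \<open>c\<close> a block with smallness constant \<open>1 / (c + 1)\<close> is
  placed on its own coordinates of \<open>\<ell>\<^sub>1\<close>, and one form carries all blocks.
  Whatever summing constant \<open>C\<close> it had, a block with \<open>c + 1 > C\<close> refutes
  it.\<close>

lemma not_all_multiple_summing: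
  fixes sm :: "'k::{real_normed_field, real_inner, banach} \<Rightarrow> 'a::real_normed_vector \<Rightarrow> 'a"
  assumes sm: "normed_space_over sm" and r: "r \<ge> 1"
    and fam: "\<And>c. c > 0 \<Longrightarrow> \<exists>t (z :: nat \<Rightarrow> 'a) \<phi>.
      (\<forall>i<2 ^ t. \<phi> i \<in> dual_ball sm \<and> 1 \<le> norm (\<phi> i (z i))) \<and>
      (\<forall>f\<in>dual_ball sm. (\<Sum>i<2 ^ t. norm (f (z i))) \<le> c * (2 ^ t) powr (2 / r - 3 / 2))"
  shows "(continuous_multilinear ell1_scale sm (*) :: (('m::finite \<Rightarrow> 'k ell1) \<Rightarrow> 'a \<Rightarrow> 'k) set)
    \<noteq> multiple_summing r 1 ell1_scale sm (*)"
proof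
  assume eq: "(continuous_multilinear ell1_scale sm (*) :: (('m \<Rightarrow> 'k ell1) \<Rightarrow> 'a \<Rightarrow> 'k) set)
    = multiple_summing r 1 ell1_scale sm (*)"
  define \<sigma> where "\<sigma> = 2 / r - 3 / 2"
  define bad where "bad c t z \<psi> \<longleftrightarrow> (\<forall>i. \<psi> i \<in> dual_ball sm) \<and>
      (2 ^ t)\<^sup>2 \<le> (\<Sum>k<2 ^ t. \<Sum>l<2 ^ t. norm (\<Sum>i<2 ^ t. sylvester t k i *\<^sub>R \<psi> i (z l)) powr r) \<and>
      (\<forall>f\<in>dual_ball sm. (\<Sum>l<2 ^ t. norm (f (z l))) \<le> 1 / (real c + 1) * (2 ^ t) powr \<sigma>)"
    for c t :: nat and z :: "nat \<Rightarrow> 'a" and \<psi> :: "nat \<Rightarrow> 'a \<Rightarrow> 'k"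
  have "\<exists>t z \<psi>. bad c t z \<psi>" for c
  proof -
    have pos: "0 < 1 / (real c + 1)" by simp
    obtain t and z :: "nat \<Rightarrow> 'a" and \<phi> where *: "\<And>i. i < 2 ^ t \<Longrightarrow> \<phi> i \<in> dual_ball sm"
      "\<And>i. i < 2 ^ t \<Longrightarrow> 1 \<le> norm (\<phi> i (z i))"
      "\<And>f. f \<in> dual_ball sm \<Longrightarrow> (\<Sum>i<2 ^ t. norm (f (z i))) \<le> 1 / (real c + 1) * (2 ^ t) powr \<sigma>"
      using fam[OF pos] unfolding \<sigma>_def by blast
    obtain \<delta> where \<delta>: "\<And>i. i < 2 ^ t \<Longrightarrow> \<bar>\<delta> i\<bar> = 1"
      "(2 ^ t)\<^sup>2 \<le> (\<Sum>k<2 ^ t. \<Sum>l<2 ^ t. norm (\<Sum>i<2 ^ t. sylvester t k i *\<^sub>R \<delta> i *\<^sub>R \<phi> i (z l)) powr r)"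
      using exists_signs_large_sylvester_sum[OF r, of t "\<lambda>i l. \<phi> i (z l)"] *(2) by auto
    \<comment> \<open>Extension by zero gives an element of the dual ball for every index.\<close>
    define \<psi> where "\<psi> i = (if i < 2 ^ t then (\<lambda>x. \<delta> i *\<^sub>R \<phi> i x) else (\<lambda>_. 0))" for i
    have "\<psi> i \<in> dual_ball sm" for i
    proof (cases "i < 2 ^ t")
      case True
      then show ?thesis using scaleR_in_dual_ball[OF sm *(1)[OF True]] \<delta>(1) by (simp add: \<psi>_def)
    next
      case False
      then show ?thesis by (simp add: \<psi>_def dual_ball_iff[OF sm])
    qed
    moreover have "(\<Sum>i<2 ^ t. sylvester t k i *\<^sub>R \<psi> i (z l)) =
        (\<Sum>i<2 ^ t. sylvester t k i *\<^sub>R \<delta> i *\<^sub>R \<phi> i (z l))" for k l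
      by (intro sum.cong) (auto simp: \<psi>_def)
    ultimately have "bad c t z \<psi>" unfolding bad_def using \<delta>(2) *(3) by simp
    then show ?thesis by blast
  qed
  then obtain t z \<psi> where bad: "\<And>c. bad c (t c) (z c) (\<psi> c)" by metis
  have \<psi>: "\<psi> c i \<in> dual_ball sm" for c i
    using bad[of c] by (simp add: bad_def)
  have large: "(2 ^ t c)\<^sup>2 \<le> (\<Sum>k<2 ^ t c. \<Sum>l<2 ^ t c.
      norm (\<Sum>i<2 ^ t c. sylvester (t c) k i *\<^sub>R \<psi> c i (z c l)) powr r)" for c
    using bad[of c] by (simp add: bad_def)
  have small: "(\<Sum>l<2 ^ t c. norm (f (z c l))) \<le> 1 / (real c + 1) * (2 ^ t c) powr \<sigma>"
    if "f \<in> dual_ball sm" for c f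
    using bad[of c] that by (simp add: bad_def)
  \<comment> \<open>The pairing function reserves the coordinates \<open>prod_encode (c, i)\<close>
    for block \<open>c\<close>.\<close>
  define \<Phi> where "\<Phi> p = \<psi> (fst (prod_decode p)) (snd (prod_decode p))" for p
  have \<Phi>: "\<Phi> p \<in> dual_ball sm" for p by (simp add: \<Phi>_def \<psi>)
  define j0 :: 'm where "j0 = undefined"
  let ?T = "multi_form \<Phi> j0"
  interpret B: bounded_bilinear "ell1_form \<Phi>" by (rule bounded_bilinear_ell1_form[OF sm \<Phi>])
  have "?T \<in> multiple_summing r 1 ell1_scale sm (*)"
    using multi_form_continuous_multilinear[where \<Phi> = \<Phi>, OF sm \<Phi>, of j0] eq by (rule subst[rotated])
  then obtain C where C: "C > 0" "\<And>(x :: 'm \<Rightarrow> nat \<Rightarrow> 'k ell1) (y :: nat \<Rightarrow> 'a).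
      ennreal_root r (\<Sum>\<^sub>\<infinity>(i, k)\<in>(UNIV :: (('m \<Rightarrow> nat) \<times> nat) set).
          ennreal (norm (?T (\<lambda>j. x j (i j)) (y k)) powr r))
      \<le> ennreal C * (\<Prod>j\<in>UNIV. weak_norm 1 ell1_scale (x j)) * weak_norm 1 sm y"
    unfolding multiple_summing_def by blast
  define c where "c = nat \<lceil>C\<rceil>"
  have c: "C < real c + 1" unfolding c_def using C(1) by linarith
  define n :: nat where "n = 2 ^ t c"
  have n: "real n > 0" "real n = 2 ^ t c" by (auto simp: n_def)
  \<comment> \<open>The factor \<open>j0\<close> is tested on the Sylvester rows in the coordinates
    of block \<open>c\<close>, every other factor on a single unit vector.\<close>
  define x where "x j = (if j = j0
      then (\<lambda>k. if k < n then \<Sum>i<n. sylvester (t c) k i *\<^sub>R ell1_unit (prod_encode (c, i)) else 0)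
      else (\<lambda>k. if k = 0 then ell1_unit 0 else 0 :: 'k ell1))" for j
  define y where "y l = (if l < n then z c l else 0)" for l

  have w0: "weak_norm 1 ell1_scale (x j0) \<le> ennreal (n powr (3 / 2))"
  proof (rule weak_norm_one_le[OF normed_space_over_ell1, where n = n])
    fix f :: "'k ell1 \<Rightarrow> 'k" assume f: "f \<in> dual_ball ell1_scale"
    note fs = functional_simps[OF normed_space_over_ell1, of "\<lambda>_. f", OF f]
    have lin: "linear f" by (intro linearI fs)
    have "(\<Sum>k<n. norm (f (x j0 k))) =
        (\<Sum>k<n. norm (\<Sum>i<n. sylvester (t c) k i *\<^sub>R f (ell1_unit (prod_encode (c, i)))))"
      by (simp add: x_def linear_sum[OF lin] linear_scale[OF lin])
    \<comment> \<open>The functional \<open>f\<close> sends unit vectors into the unit ball of the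
      scalars, so the Sylvester estimate applies.\<close>
    also have "\<dots> \<le> n powr (3 / 2)"
      unfolding n_def of_nat_power of_nat_numeral
      using fs(3)[of "ell1_unit _"] by (intro sum_norm_sylvester_le) (simp add: norm_ell1_unit)
    finally show "(\<Sum>k<n. norm (f (x j0 k))) \<le> n powr (3 / 2)" .
  qed (simp add: x_def)
  have w1: "weak_norm 1 ell1_scale (x j) \<le> 1" if "j \<noteq> j0" for j
  proof -
    have "weak_norm 1 ell1_scale (x j) \<le> ennreal 1"
    proof (rule weak_norm_one_le[OF normed_space_over_ell1, where n = 1])
      fix f :: "'k ell1 \<Rightarrow> 'k" assume f: "f \<in> dual_ball ell1_scale"
      show "(\<Sum>i<1. norm (f (x j i))) \<le> 1"
        using functional_simps(3)[OF normed_space_over_ell1, of "\<lambda>_. f" _ "ell1_unit 0", OF f] that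
        by (simp add: x_def norm_ell1_unit)
    qed (use that in \<open>simp add: x_def\<close>)
    then show ?thesis by simp
  qed
  have wy: "weak_norm 1 sm y \<le> ennreal (1 / (real c + 1) * n powr \<sigma>)"
  proof (rule weak_norm_one_le[OF sm, where n = n])
    show "(\<Sum>i<n. norm (f (y i))) \<le> 1 / (real c + 1) * n powr \<sigma>" if "f \<in> dual_ball sm" for f
      using small[OF that, of c] by (simp add: y_def n_def)
  qed (simp add: y_def)

  \<comment> \<open>The index 0 selects the unit vector in every factor other than
    \<open>j0\<close>.\<close>
  define e where "e k = (\<lambda>j. if j = j0 then k else 0 :: nat)" for k
  have T: "?T (\<lambda>j. x j (e k j)) (y l) = (\<Sum>i<n. sylvester (t c) k i *\<^sub>R \<psi> c i (z c l))"
    if "k < n" "l < n" for k l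
  proof -
    have "(\<Prod>j\<in>UNIV - {j0}. ell1_nth (x j (e k j)) 0) = 1"
      by (intro prod.neutral) (auto simp: x_def e_def ell1_unit.rep_eq)
    then show ?thesis
      using that
      by (simp add: multi_form_def[where \<Phi> = \<Phi>, OF sm \<Phi>] x_def e_def y_def B.sum_left B.scaleR_left
          ell1_form_unit[where \<Phi> = \<Phi>, OF sm \<Phi>] \<Phi>_def)
  qed
  let ?f = "\<lambda>(i, k). ennreal (norm (?T (\<lambda>j. x j (i j)) (y k)) powr r)"
  have "ennreal ((real n)\<^sup>2) \<le> (\<Sum>\<^sub>\<infinity>q\<in>UNIV. ?f q)"
  proof -
    \<comment> \<open>The sum over all indices dominates its part over the embedded square
      \<open>?Q\<close>.\<close>
    let ?emb = "\<lambda>(k, l). (e k, l)" and ?Q = "{..<n} \<times> {..<n}"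
    have inj: "inj_on ?emb ?Q" by (auto simp: inj_on_def e_def fun_eq_iff)
    have "ennreal ((real n)\<^sup>2) \<le> ennreal (\<Sum>k<n. \<Sum>l<n.
        norm (\<Sum>i<n. sylvester (t c) k i *\<^sub>R \<psi> c i (z c l)) powr r)"
      using large[of c] by (intro ennreal_leI) (simp add: n_def)
    also have "\<dots> = ennreal (\<Sum>(k, l)\<in>?Q. norm (?T (\<lambda>j. x j (e k j)) (y l)) powr r)"
      by (simp add: T sum.cartesian_product[symmetric])
    also have "\<dots> = (\<Sum>q\<in>?emb ` ?Q. ?f q)"
      unfolding sum.reindex[OF inj] by (simp add: case_prod_beta sum_ennreal)
    also have "\<dots> \<le> (\<Sum>\<^sub>\<infinity>q\<in>UNIV. ?f q)"
      by (subst nonneg_infsum_complete) (auto intro!: SUP_upper)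
    finally show ?thesis .
  qed
  then have "ennreal ((real n)\<^sup>2 powr (1 / r)) \<le> ennreal_root r (\<Sum>\<^sub>\<infinity>q\<in>UNIV. ?f q)"
    using r by (intro ennreal_root_ge) auto
  also have "\<dots> \<le> ennreal C * (\<Prod>j\<in>UNIV. weak_norm 1 ell1_scale (x j)) * weak_norm 1 sm y"
    by (rule C(2))
  also have "\<dots> \<le> ennreal C * ennreal (n powr (3 / 2)) * ennreal (1 / (real c + 1) * n powr \<sigma>)"
    by (intro mult_mono prod_ennreal_le[where w = "\<lambda>j. weak_norm 1 ell1_scale (x j)", OF w0 w1] wy) auto
  also have "\<dots> = ennreal (C * n powr (3 / 2) * (1 / (real c + 1) * n powr \<sigma>))"
    using C(1) ennreal_mult[of C "n powr (3 / 2)"]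
      ennreal_mult[of "C * n powr (3 / 2)" "1 / (real c + 1) * n powr \<sigma>"] by simp
  finally have "(real n)\<^sup>2 powr (1 / r) \<le> C * n powr (3 / 2) * (1 / (real c + 1) * n powr \<sigma>)"
    using C(1) by (simp add: ennreal_le_iff)
  moreover have "(real n)\<^sup>2 powr (1 / r) = n powr (2 / r)"
    using n(1) by (simp add: powr_powr flip: powr_numeral)
  \<comment> \<open>By the choice of \<open>\<sigma>\<close> both sides carry the same power of
    \<open>n\<close>, and only \<open>1 \<le> C / (real c + 1)\<close> remains.\<close>
  moreover have "n powr (2 / r) = n powr (3 / 2) * n powr \<sigma>"
    by (simp add: \<sigma>_def flip: powr_add)
  ultimately have "1 * (n powr (3 / 2) * n powr \<sigma>) \<le> C / (real c + 1) * (n powr (3 / 2) * n powr \<sigma>)"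
    by (simp add: mult_ac)
  moreover have "n powr (3 / 2) * n powr \<sigma> > 0" using n(1) by simp
  ultimately have "1 \<le> C / (real c + 1)" by (simp only: mult_le_cancel_right_pos)
  then show False using c C(1) by (simp add: field_simps)
qed

text \<open>Solving \<open>b = 4 * q / (3 * q + 2)\<close> for \<open>1 / q\<close> gives
  \<open>2 / b - 3 / 2\<close>; the value \<open>b = 4 / 3\<close> corresponds to the reciprocal 0
  of \<open>\<infinity>\<close>.\<close>

lemma cotype_recip_less_of_less_cotype_bound:
  assumes "1 \<le> r" "r < cotype_bound q" "2 \<le> q"
  shows "cotype_recip q < 2 / r - 3 / 2"
proof (cases q)
  case (real s)
  have "s \<ge> 2" using assms(3) real by simp
  then have "cotype_recip q = 2 / (4 * s / (3 * s + 2)) - 3 / 2"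
    by (simp add: cotype_recip_def real field_simps)
  also have "\<dots> < 2 / r - 3 / 2"
    using assms(1,2) real \<open>s \<ge> 2\<close> by (intro diff_strict_right_mono divide_strict_left_mono) (auto simp: cotype_bound_def)
  finally show ?thesis .
qed (use assms in \<open>auto simp: cotype_bound_def cotype_recip_def field_simps\<close>)

text \<open>The assumptions \<open>norming\<close> and \<open>real_part\<close> connect the dual
  ball over \<open>'k\<close> with the real one, so that both scalar fields share the
  argument.\<close>

lemma not_all_multiple_summing_of_less_cotype_bound:
  fixes sm :: "'k::{real_normed_field, real_inner, banach} \<Rightarrow> 'a::real_normed_vector \<Rightarrow> 'a"
  assumes sm: "normed_space_over sm" and r: "r \<ge> 1" "r < cotype_bound (cotype_index TYPE('a))"
    and norming: "\<And>x. \<exists>f\<in>dual_ball sm. norm x \<le> norm (f x)"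
    and real_part: "\<And>f. f \<in> dual_ball sm \<Longrightarrow>
      \<exists>g\<in>real_dual_ball. \<exists>h\<in>real_dual_ball. \<forall>x. norm (f x) \<le> \<bar>g x\<bar> + \<bar>h x\<bar>"
  shows "(continuous_multilinear ell1_scale sm (*) :: (('m::finite \<Rightarrow> 'k ell1) \<Rightarrow> 'a \<Rightarrow> 'k) set)
    \<noteq> multiple_summing r 1 ell1_scale sm (*)"
proof (rule not_all_multiple_summing[OF sm r(1)])
  fix c :: real assume "c > 0"
  define \<sigma> where "\<sigma> = 2 / r - 3 / 2"
  have "cotype_recip (cotype_index TYPE('a)) < \<sigma>" "\<sigma> \<le> 1 / 2"
    using cotype_recip_less_of_less_cotype_bound[OF r cotype_index_ge_2] r(1)
    by (auto simp: \<sigma>_def field_simps)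
  \<comment> \<open>The constant is \<open>c / 2\<close> because each functional is dominated by two
    real ones.\<close>
  then obtain t and z :: "nat \<Rightarrow> 'a" where z: "\<And>i. i < 2 ^ t \<Longrightarrow> norm (z i) \<ge> 1"
    "\<And>g. g \<in> real_dual_ball \<Longrightarrow> (\<Sum>i<2 ^ t. \<bar>g (z i)\<bar>) \<le> c / 2 * (2 ^ t) powr \<sigma>"
    using exists_weakly_small_family[of \<sigma> "c / 2", where 'a='a] \<open>c > 0\<close> by auto
  have "\<forall>i. \<exists>f. f \<in> dual_ball sm \<and> norm (z i) \<le> norm (f (z i))"
    using norming by blast
  then obtain \<phi> where \<phi>: "\<And>i. \<phi> i \<in> dual_ball sm" "\<And>i. norm (z i) \<le> norm (\<phi> i (z i))"
    using choice[of "\<lambda>i f. f \<in> dual_ball sm \<and> norm (z i) \<le> norm (f (z i))"] by blast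
  have "(\<Sum>i<2 ^ t. norm (f (z i))) \<le> c * (2 ^ t) powr \<sigma>" if f: "f \<in> dual_ball sm" for f
  proof -
    obtain g h where gh: "g \<in> real_dual_ball" "h \<in> real_dual_ball" "\<And>x. norm (f x) \<le> \<bar>g x\<bar> + \<bar>h x\<bar>"
      using real_part[OF f] by blast
    have "(\<Sum>i<2 ^ t. norm (f (z i))) \<le> (\<Sum>i<2 ^ t. \<bar>g (z i)\<bar>) + (\<Sum>i<2 ^ t. \<bar>h (z i)\<bar>)"
      unfolding sum.distrib[symmetric] by (intro sum_mono gh(3))
    also have "\<dots> \<le> c / 2 * (2 ^ t) powr \<sigma> + c / 2 * (2 ^ t) powr \<sigma>"
      by (intro add_mono z(2) gh)
    finally show ?thesis by simp
  qed
  then show "\<exists>t (z :: nat \<Rightarrow> 'a) \<phi>. (\<forall>i<2 ^ t. \<phi> i \<in> dual_ball sm \<and> 1 \<le> norm (\<phi> i (z i))) \<and>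
      (\<forall>f\<in>dual_ball sm. (\<Sum>i<2 ^ t. norm (f (z i))) \<le> c * (2 ^ t) powr (2 / r - 3 / 2))"
    using \<phi>(1) order_trans[OF z(1) \<phi>(2)]
    by (intro exI[of _ t] exI[of _ z] exI[of _ \<phi>]) (auto simp: \<sigma>_def)
qed

theorem theorem4p3:
  fixes r :: real and cscale :: "complex \<Rightarrow> 'c::banach \<Rightarrow> 'c"
  assumes "r \<ge> 1"
  shows
    "(infinite_dimensional (scaleR :: real \<Rightarrow> 'b::banach \<Rightarrow> 'b) \<and>
      (continuous_multilinear ell1_scale scaleR (*)
          :: (('m::finite \<Rightarrow> real ell1) \<Rightarrow> 'b \<Rightarrow> real) set)
        = multiple_summing r 1 ell1_scale scaleR (*)
      \<longrightarrow> r \<ge> cotype_bound (cotype_index TYPE('b)))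
     \<and>
     (normed_space_over cscale \<and> infinite_dimensional cscale \<and>
      (continuous_multilinear ell1_scale cscale (*)
          :: (('m::finite \<Rightarrow> complex ell1) \<Rightarrow> 'c \<Rightarrow> complex) set)
        = multiple_summing r 1 ell1_scale cscale (*)
      \<longrightarrow> r \<ge> cotype_bound (cotype_index TYPE('c)))"
proof (intro conjI impI; elim conjE; rule ccontr)
  assume eq: "(continuous_multilinear ell1_scale scaleR (*) :: (('m \<Rightarrow> real ell1) \<Rightarrow> 'b \<Rightarrow> real) set)
      = multiple_summing r 1 ell1_scale scaleR (*)"
    and less: "\<not> r \<ge> cotype_bound (cotype_index TYPE('b))"
  have "(continuous_multilinear ell1_scale scaleR (*) :: (('m \<Rightarrow> real ell1) \<Rightarrow> 'b \<Rightarrow> real) set)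
      \<noteq> multiple_summing r 1 ell1_scale scaleR (*)"
  proof (rule not_all_multiple_summing_of_less_cotype_bound[OF normed_space_over_scaleR assms])
    show "\<exists>f\<in>dual_ball scaleR. norm x \<le> norm (f x)" for x :: 'b
      using exists_norming_functional[of x] by (force simp: dual_ball_scaleR)
    \<comment> \<open>Here \<open>g = h = f\<close> works.\<close>
    show "\<exists>g\<in>real_dual_ball. \<exists>h\<in>real_dual_ball. \<forall>x. norm (f x) \<le> \<bar>g x\<bar> + \<bar>h x\<bar>"
      if "f \<in> dual_ball scaleR" for f :: "'b \<Rightarrow> real"
      using that by (force simp: dual_ball_scaleR)
  qed (use less in simp)
  then show False using eq by contradiction
next
  assume sm: "normed_space_over cscale"
    and eq: "(continuous_multilinear ell1_scale cscale (*) :: (('m \<Rightarrow> complex ell1) \<Rightarrow> 'c \<Rightarrow> complex) set)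
      = multiple_summing r 1 ell1_scale cscale (*)"
    and less: "\<not> r \<ge> cotype_bound (cotype_index TYPE('c))"
  have "(continuous_multilinear ell1_scale cscale (*) :: (('m \<Rightarrow> complex ell1) \<Rightarrow> 'c \<Rightarrow> complex) set)
      \<noteq> multiple_summing r 1 ell1_scale cscale (*)"
  proof (rule not_all_multiple_summing_of_less_cotype_bound[OF sm assms])
    show "\<exists>f\<in>dual_ball cscale. norm x \<le> norm (f x)" for x :: 'c
      by (rule exists_complex_norming_functional[OF sm])
    \<comment> \<open>Here \<open>g\<close> and \<open>h\<close> are the real and the imaginary part
      of \<open>f\<close>.\<close>
    show "\<exists>g\<in>real_dual_ball. \<exists>h\<in>real_dual_ball. \<forall>x. norm (f x) \<le> \<bar>g x\<bar> + \<bar>h x\<bar>"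
      if "f \<in> dual_ball cscale" for f
      using cmod_le
      by (intro bexI[OF _ Re_Im_in_real_dual_ball(1)[OF sm that]]
          bexI[OF _ Re_Im_in_real_dual_ball(2)[OF sm that]]) auto
  qed (use less in simp)
  then show False using eq by contradiction
qed

end
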